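(* \textsc{MD-RSPP} is fixed-parameter tractable when parameterized by the number $|K|$ of commodities.
   Context: For a digraph $D=(V,E)$, $\mathcal{T}(D)$ is its transitive closure (edge $(i,j)$ iff $D$ has a directed $i$-$j$-path). \textsc{MD-RSPP}: input is a digraph $D=(V,E)$, an integer $T$, and a set $K\subseteq V\times V$ of commodities; the question is whether there is a subgraph $H$ of $\mathcal{T}(D)$ of maximum outdegree at most $T$ such that for every $(s,t)\in K$ there is a directed $s$-$t$-path in $H$. *)

theory Defs
  imports "Graph_Theory.Graph_Theory" "HOL-Library.Log_Nat"
begin

section \<open>The decision problem\<close>

text \<open>As usual the path of length zero counts as a directed path, both here (where it produces a
  loop at every vertex) and for commodities \<open>(s, s)\<close>. Loops in the transitive closure
  have no influence on the problem: a subgraph need not use them, and they connect nothing new.\<close>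

definition transitive_closure :: "'a pair_pre_digraph \<Rightarrow> 'a pair_pre_digraph" where
  "transitive_closure D = \<lparr> pverts = pverts D, parcs = {(i, j). i \<rightarrow>\<^sup>*\<^bsub>with_proj D\<^esub> j} \<rparr>"

text \<open>Inserting 0 fixes the maximum outdegree of the digraph without vertices to be 0.\<close>

definition max_out_degree :: "('a, 'b) pre_digraph \<Rightarrow> nat" where
  "max_out_degree H = Max (insert 0 (out_degree H ` verts H))"

definition MD_RSPP :: "'a pair_pre_digraph \<times> int \<times> ('a \<times> 'a) set \<Rightarrow> bool" where
  "MD_RSPP = (\<lambda>(D, T, K).
     \<exists>H :: 'a pair_pre_digraph.
       subgraph (with_proj H) (with_proj (transitive_closure D)) \<and>
       int (max_out_degree (with_proj H)) \<le> T \<and>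
       (\<forall>(s, t) \<in> K. s \<rightarrow>\<^sup>*\<^bsub>with_proj H\<^esub> t))"


section \<open>Random access machines\<close>

text \<open>
  The machine model is the unit-cost random access machine of Cook and Reckhow with addition and
  truncated subtraction as its only arithmetic operations (no unit-cost multiplication), which
  is polynomially equivalent to multitape Turing machines. Programs are written with structured
  control flow instead of jumps. The memory consists of registers and of infinite arrays with
  indirect addressing; a program mentions only finitely many of each, so that they can be
  interleaved in one linear memory.
\<close>

datatype com =
    Skip
  | Const nat nat          \<comment> \<open>\<open>r\<^sub>x := c\<close>\<close>
  | Add nat nat nat        \<comment> \<open>\<open>r\<^sub>x := r\<^sub>y + r\<^sub>z\<close>\<close>
  | Sub nat nat nat        \<comment> \<open>\<open>r\<^sub>x := r\<^sub>y - r\<^sub>z\<close>, truncated at 0\<close>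
  | Load nat nat nat       \<comment> \<open>\<open>r\<^sub>x := A\<^sub>a[r\<^sub>y]\<close>\<close>
  | Store nat nat nat      \<comment> \<open>\<open>A\<^sub>a[r\<^sub>x] := r\<^sub>y\<close>\<close>
  | Seq com com
  | Cond nat com com       \<comment> \<open>first branch iff \<open>r\<^sub>x \<noteq> 0\<close>\<close>
  | While nat com          \<comment> \<open>loop as long as \<open>r\<^sub>x \<noteq> 0\<close>\<close>

type_synonym state = "(nat \<Rightarrow> nat) \<times> (nat \<Rightarrow> nat \<Rightarrow> nat)"

text \<open>\<open>exec c s t s'\<close>: started in state \<open>s\<close>, the program \<open>c\<close> halts in
  state \<open>s'\<close> after exactly \<open>t\<close> steps.\<close>

inductive exec :: "com \<Rightarrow> state \<Rightarrow> nat \<Rightarrow> state \<Rightarrow> bool" where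
  Skip: "exec Skip s 1 s"
| Const: "exec (Const x c) (r, A) 1 (r(x := c), A)"
| Add: "exec (Add x y z) (r, A) 1 (r(x := r y + r z), A)"
| Sub: "exec (Sub x y z) (r, A) 1 (r(x := r y - r z), A)"
| Load: "exec (Load x a y) (r, A) 1 (r(x := A a (r y)), A)"
| Store: "exec (Store a x y) (r, A) 1 (r, A(a := (A a)(r x := r y)))"
| Seq: "exec c s t s' \<Longrightarrow> exec d s' u s'' \<Longrightarrow> exec (Seq c d) s (t + u) s''"
| Cond_True: "r x \<noteq> 0 \<Longrightarrow> exec c (r, A) t s' \<Longrightarrow> exec (Cond x c d) (r, A) (t + 1) s'"
| Cond_False: "r x = 0 \<Longrightarrow> exec d (r, A) t s' \<Longrightarrow> exec (Cond x c d) (r, A) (t + 1) s'"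
| While_False: "r x = 0 \<Longrightarrow> exec (While x c) (r, A) 1 (r, A)"
| While_True: "r x \<noteq> 0 \<Longrightarrow> exec c (r, A) t s' \<Longrightarrow> exec (While x c) s' u s''
    \<Longrightarrow> exec (While x c) (r, A) (t + u + 1) s''"

text \<open>Executions are deterministic, so that asking for the existence of a halting execution
  below is the same as asking the program to halt with that result.\<close>

lemma exec_deterministic:
  assumes "exec c s t s'" "exec c s u s''"
  shows "t = u \<and> s' = s''"
  using assms
proof (induction arbitrary: u s'' rule: exec.induct)
  case (Seq c s t s' d u' s0)
  from Seq.prems obtain t1 s1 u1
    where "exec c s t1 s1" "exec d s1 u1 s''" "u = t1 + u1" by (cases) auto
  with Seq.IH show ?case by blast
next
  case (Cond_True r x c A t s' d)
  from Cond_True.prems Cond_True.hyps obtain t1 where "exec c (r, A) t1 s''" "u = t1 + 1"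
    by (cases) auto
  with Cond_True.IH show ?case by blast
next
  case (Cond_False r x d A t s' c)
  from Cond_False.prems Cond_False.hyps obtain t1 where "exec d (r, A) t1 s''" "u = t1 + 1"
    by (cases) auto
  with Cond_False.IH show ?case by blast
next
  case (While_True r x c A t s' u' s0)
  from While_True.prems While_True.hyps obtain t1 s1 u1
    where "exec c (r, A) t1 s1" "exec (While x c) s1 u1 s''" "u = t1 + u1 + 1" by (cases) auto
  with While_True.IH show ?case by blast
qed (auto elim: exec.cases)

text \<open>The input word is placed in array 0 and its length in register 0; the output is read off
  register 0.\<close>

definition init_state :: "nat list \<Rightarrow> state" where
  "init_state xs = ((\<lambda>_. 0)(0 := length xs),
     (\<lambda>_ _. 0)(0 := (\<lambda>i. if i < length xs then xs ! i else 0)))"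

definition result :: "state \<Rightarrow> nat" where
  "result s = fst s 0"

definition computable :: "(nat \<Rightarrow> nat) \<Rightarrow> bool" where
  "computable f \<longleftrightarrow> (\<exists>c. \<forall>k. \<exists>t s'. exec c (init_state [k]) t s' \<and> result s' = f k)"


section \<open>Fixed-parameter tractability\<close>

text \<open>\<open>floorlog 2 x\<close> is the length of the binary representation of \<open>x\<close>; one further unit
  per entry accounts for the separator. In particular numbers in the input count with their binary
  length.\<close>

definition input_size :: "nat list \<Rightarrow> nat" where
  "input_size xs = (\<Sum>x\<leftarrow>xs. floorlog 2 x + 1)"

text \<open>A parameterized problem is given by its set of instances \<open>X\<close>, an encoding of the instances
  as input words, the parameter, and the yes-instances. It is fixed-parameter tractable if a single
  program decides every instance \<open>I\<close> within \<open>f k * n ^ d\<close> steps, where \<open>k\<close> is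
  its parameter, \<open>n\<close> its size, \<open>f\<close> a computable function and \<open>d\<close> a constant.\<close>

definition fixed_parameter_tractable ::
  "'i set \<Rightarrow> ('i \<Rightarrow> nat list) \<Rightarrow> ('i \<Rightarrow> nat) \<Rightarrow> ('i \<Rightarrow> bool) \<Rightarrow> bool" where
  "fixed_parameter_tractable X enc param P \<longleftrightarrow>
     (\<exists>c f d. computable f \<and>
        (\<forall>I \<in> X. \<exists>t s'. exec c (init_state (enc I)) t s' \<and>
           t \<le> f (param I) * input_size (enc I) ^ d \<and>
           (result s' \<noteq> 0 \<longleftrightarrow> P I)))"


section \<open>Instances and their encoding\<close>

text \<open>As for every encoding of graphs as words, the vertices are numbered consecutively.\<close>

type_synonym inst = "nat pair_pre_digraph \<times> int \<times> (nat \<times> nat) set"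

definition MD_RSPP_instances :: "inst set" where
  "MD_RSPP_instances = {(D, T, K).
     pair_fin_digraph D \<and> (\<exists>n. pverts D = {..<n}) \<and> K \<subseteq> pverts D \<times> pverts D}"

text \<open>The 0-1-matrix of a relation on \<open>{..<n}\<close>, row by row.\<close>

definition adjacency_matrix :: "nat \<Rightarrow> (nat \<times> nat) set \<Rightarrow> nat list" where
  "adjacency_matrix n R = map (\<lambda>e. of_bool (e \<in> R)) (List.product [0..<n] [0..<n])"

definition encode :: "inst \<Rightarrow> nat list" where
  "encode = (\<lambda>(D, T, K).
     [card (pverts D), of_bool (T < 0), nat \<bar>T\<bar>] @
     adjacency_matrix (card (pverts D)) (parcs D) @
     adjacency_matrix (card (pverts D)) K)"

definition num_commodities :: "inst \<Rightarrow> nat" where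
  "num_commodities = (\<lambda>(D, T, K). card K)"

lemma length_adjacency_matrix: "length (adjacency_matrix n R) = n * n"
  by (simp add: adjacency_matrix_def)

lemma adjacency_matrix_inject:
  assumes "adjacency_matrix n R = adjacency_matrix n S"
    and "R \<subseteq> {..<n} \<times> {..<n}" "S \<subseteq> {..<n} \<times> {..<n}"
  shows "R = S"
proof -
  have "\<forall>e \<in> {..<n} \<times> {..<n}. e \<in> R \<longleftrightarrow> e \<in> S"
    using assms(1) by (auto simp: adjacency_matrix_def of_bool_eq_iff)
  with assms(2,3) show ?thesis by blast
qed

lemma inj_on_encode: "inj_on encode MD_RSPP_instances"
proof (rule inj_onI)
  fix I J assume I: "I \<in> MD_RSPP_instances" and J: "J \<in> MD_RSPP_instances"
    and eq: "encode I = encode J"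
  obtain D T K where I': "I = (D, T, K)" by (cases I)
  obtain D' T' K' where J': "J = (D', T', K')" by (cases J)
  from I I' obtain n where n: "pverts D = {..<n}" "K \<subseteq> {..<n} \<times> {..<n}" "pair_fin_digraph D"
    by (auto simp: MD_RSPP_instances_def)
  from J J' obtain m where m: "pverts D' = {..<m}" "K' \<subseteq> {..<m} \<times> {..<m}" "pair_fin_digraph D'"
    by (auto simp: MD_RSPP_instances_def)
  have E: "parcs G \<subseteq> pverts G \<times> pverts G" if "pair_fin_digraph G" for G :: "nat pair_pre_digraph"
  proof -
    interpret pair_fin_digraph G by fact
    show ?thesis using wellformed' by auto
  qed
  have "n = m" and TT: "(T < 0) = (T' < 0)" "nat \<bar>T\<bar> = nat \<bar>T'\<bar>"
    using eq by (simp_all add: encode_def I' J' n(1) m(1) of_bool_eq_iff)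
  have "parcs D = parcs D'"
  proof (rule adjacency_matrix_inject)
    show "adjacency_matrix n (parcs D) = adjacency_matrix n (parcs D')"
      using eq \<open>n = m\<close> by (simp add: encode_def I' J' n(1) m(1) length_adjacency_matrix)
  qed (use E[OF n(3)] E[OF m(3)] n(1) m(1) \<open>n = m\<close> in simp_all)
  moreover have "K = K'"
  proof (rule adjacency_matrix_inject)
    show "adjacency_matrix n K = adjacency_matrix n K'"
      using eq \<open>n = m\<close> by (simp add: encode_def I' J' n(1) m(1) length_adjacency_matrix)
  qed (use n(2) m(2) \<open>n = m\<close> in simp_all)
  moreover have "T = T'" using TT by linarith
  ultimately show "I = J" using \<open>n = m\<close> n(1) m(1) by (simp add: I' J')
qed

end

theory Submission
  imports Defs
begin

text \<open>
  A solution with the fewest arcs is small. Each of its arcs is indispensable for some commodity, a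
  nonterminal with a single outgoing arc could be bypassed, and no vertex has two arcs inside its
  strong component, because a Hamiltonian cycle through the component would use fewer arcs. Two
  commodities can then diverge at no more than two vertices, and so at most \<open>2k\<^sup>2 + 2k\<close>
  vertices are incident with an arc or a commodity.

  This allows colour coding. Some bounded set of bit positions distinguishes these vertices, so the
  hash functions needed can be enumerated as bit masks \<open>y < 2n + 2\<close>. For each colouring and
  each digraph \<open>P\<close> on the colours one computes the greatest set of vertices that can simulate
  their colours in \<open>P\<close>. No consistent embedding of \<open>P\<close> has to be found: vertices of
  the same colour may coexist, since each has its own bounded set of outgoing arcs.
\<close>

section \<open>A small programming language\<close>

text \<open>The running time is controlled by a single number. With
  \<open>q = 2 * k * (k + 1)\<close> vertices to be told apart, \<open>q\<close> bit positions give
  \<open>C = 2 ^ q\<close> colours, and there are \<open>R = 2 ^ (C * C)\<close> digraphs on them.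
  Every loop of the program, including those that replace multiplication, makes at most
  \<open>M = R + 2 * n + 2\<close> rounds. A program of bounded loops then halts within
  \<open>(M + 3) ^ d\<close> steps for an exponent \<open>d\<close> read off its text, and
  \<open>M + 3\<close> is at most \<open>8 * R\<close> times the input size, so the bound splits
  into a function of \<open>k\<close> and a polynomial. Such a generous bound makes brute force
  affordable: bits are found by searching for a quotient, and reachability among colours by
  enumerating all sets of colours. The degree bound \<open>T\<close> is written in binary and may be
  exponential in the input size; it therefore never bounds a loop and is only compared with
  outdegrees. The source language has only loops whose number of rounds is fixed on entry. Its
  programs are total functions on states, so correctness is proved for these functions and carried
  over to machine runs once and for all.\<close>

datatype exp =
    Num nat
  | Var nat
  | Plus exp exp
  | Minus exp exp
  | Arr nat exp
  | If exp exp exp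
  | Sum nat nat exp

datatype stmt =
    Assign nat exp
  | Upd nat exp exp
  | Then stmt stmt (infixr ";;" 60)
  | For nat nat stmt

definition set_reg :: "nat \<Rightarrow> nat \<Rightarrow> state \<Rightarrow> state" where
  "set_reg x i s = ((fst s)(x := i), snd s)"

lemma set_reg_simps [simp]:
  "set_reg x i (r, A) = (r(x := i), A)" "fst (set_reg x i s) = (fst s)(x := i)"
  "snd (set_reg x i s) = snd s"
  by (simp_all add: set_reg_def)

primrec eval :: "exp \<Rightarrow> state \<Rightarrow> nat" where
  "eval (Num c) s = c"
| "eval (Var x) s = fst s x"
| "eval (Plus a b) s = eval a s + eval b s"
| "eval (Minus a b) s = eval a s - eval b s"
| "eval (Arr a e) s = snd s a (eval e s)"
| "eval (If g a b) s = (if eval g s \<noteq> 0 then eval a s else eval b s)"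
| "eval (Sum x b e) s = (\<Sum>i<fst s b. eval e (set_reg x i s))"

primrec iter :: "(nat \<Rightarrow> 'a \<Rightarrow> 'a) \<Rightarrow> nat \<Rightarrow> 'a \<Rightarrow> 'a" where
  "iter f 0 s = s"
| "iter f (Suc i) s = f i (iter f i s)"

primrec sem :: "stmt \<Rightarrow> state \<Rightarrow> state" where
  "sem (Assign x e) s = ((fst s)(x := eval e s), snd s)"
| "sem (Upd a i e) s = (fst s, (snd s)(a := (snd s a)(eval i s := eval e s)))"
| "sem (p ;; q) s = sem q (sem p s)"
| "sem (For x b p) s = iter (\<lambda>i t. sem p (set_reg x i t)) (fst s b) s"

text \<open>Loop bounds are register contents known only at run time, so the cost estimate needs a
  side condition on the run. Both branches of \<open>If\<close> are included, as the cost estimate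
  pays for both.\<close>

primrec ebounded :: "nat \<Rightarrow> exp \<Rightarrow> state \<Rightarrow> bool" where
  "ebounded B (Num c) s = True"
| "ebounded B (Var x) s = True"
| "ebounded B (Plus a b) s = (ebounded B a s \<and> ebounded B b s)"
| "ebounded B (Minus a b) s = (ebounded B a s \<and> ebounded B b s)"
| "ebounded B (Arr a e) s = ebounded B e s"
| "ebounded B (If g a b) s = (ebounded B g s \<and> ebounded B a s \<and> ebounded B b s)"
| "ebounded B (Sum x b e) s = (fst s b \<le> B \<and> (\<forall>i<fst s b. ebounded B e (set_reg x i s)))"

primrec bounded :: "nat \<Rightarrow> stmt \<Rightarrow> state \<Rightarrow> bool" where
  "bounded B (Assign x e) s = ebounded B e s"
| "bounded B (Upd a i e) s = (ebounded B i s \<and> ebounded B e s)"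
| "bounded B (p ;; q) s = (bounded B p s \<and> bounded B q (sem p s))"
| "bounded B (For x b p) s = (fst s b \<le> B \<and>
     (\<forall>i<fst s b. bounded B p (set_reg x i (iter (\<lambda>i t. sem p (set_reg x i t)) i s))))"

text \<open>The summation variable counts as occurring, because the compiled sum overwrites it
  temporarily; the evaluation stack has to stay clear of it.\<close>

primrec evars :: "exp \<Rightarrow> nat set" where
  "evars (Num c) = {}"
| "evars (Var x) = {x}"
| "evars (Plus a b) = evars a \<union> evars b"
| "evars (Minus a b) = evars a \<union> evars b"
| "evars (Arr a e) = evars e"
| "evars (If g a b) = evars g \<union> evars a \<union> evars b"
| "evars (Sum x b e) = {x, b} \<union> evars e"

primrec vars :: "stmt \<Rightarrow> nat set" where
  "vars (Assign x e) = {x} \<union> evars e"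
| "vars (Upd a i e) = evars i \<union> evars e"
| "vars (p ;; q) = vars p \<union> vars q"
| "vars (For x b p) = {x, b} \<union> vars p"

text \<open>Registers from \<open>d\<close> on serve as an evaluation stack.\<close>

primrec cexp :: "exp \<Rightarrow> nat \<Rightarrow> com" where
  "cexp (Num c) d = Const d c"
| "cexp (Var x) d = Seq (Const d 0) (Add d d x)"
| "cexp (Plus a b) d = Seq (cexp a d) (Seq (cexp b (d + 1)) (Add d d (d + 1)))"
| "cexp (Minus a b) d = Seq (cexp a d) (Seq (cexp b (d + 1)) (Sub d d (d + 1)))"
| "cexp (Arr a e) d = Seq (cexp e d) (Load d a d)"
| "cexp (If g a b) d = Seq (cexp g d) (Cond d (cexp a d) (cexp b d))"
| "cexp (Sum x b e) d =
     Seq (Const d 0) (Seq (Add (d + 1) d b) (Seq (Add (d + 2) d x)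
     (Seq (While (d + 1)
       (Seq (Const (d + 3) 1) (Seq (Sub (d + 1) (d + 1) (d + 3))
       (Seq (Const (d + 3) 0) (Seq (Add x (d + 1) (d + 3))
       (Seq (cexp e (d + 3)) (Add d d (d + 3))))))))
     (Seq (Const (d + 3) 0) (Add x (d + 2) (d + 3))))))"

text \<open>A loop keeps its counter at \<open>d\<close> and the number of remaining rounds at
  \<open>d + 1\<close>, hence its body works from \<open>d + 2\<close> on. The counter is copied to
  \<open>x\<close> at the start of every round and the bound is read once, so the body may overwrite
  both registers, in agreement with \<open>sem\<close>.\<close>

primrec cstmt :: "stmt \<Rightarrow> nat \<Rightarrow> com" where
  "cstmt (Assign x e) d = Seq (cexp e d) (Seq (Const (d + 1) 0) (Add x d (d + 1)))"
| "cstmt (Upd a i e) d = Seq (cexp i d) (Seq (cexp e (d + 1)) (Store a d (d + 1)))"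
| "cstmt (p ;; q) d = Seq (cstmt p d) (cstmt q d)"
| "cstmt (For x b p) d =
     Seq (Const d 0) (Seq (Add (d + 1) d b)
     (While (d + 1)
       (Seq (Const (d + 2) 0) (Seq (Add x d (d + 2))
       (Seq (cstmt p (d + 2))
       (Seq (Const (d + 2) 1) (Seq (Sub (d + 1) (d + 1) (d + 2)) (Add d d (d + 2)))))))))"

text \<open>Worst-case running time if no loop makes more than \<open>B\<close> iterations.\<close>

primrec wcost :: "nat \<Rightarrow> com \<Rightarrow> nat" where
  "wcost B Skip = 1"
| "wcost B (Const x c) = 1"
| "wcost B (Add x y z) = 1"
| "wcost B (Sub x y z) = 1"
| "wcost B (Load x a y) = 1"
| "wcost B (Store a x y) = 1"
| "wcost B (Seq c d) = wcost B c + wcost B d"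
| "wcost B (Cond x c d) = wcost B c + wcost B d + 1"
| "wcost B (While x c) = B * (wcost B c + 1) + 1"

primrec weight :: "com \<Rightarrow> nat" where
  "weight Skip = 1"
| "weight (Const x c) = 1"
| "weight (Add x y z) = 1"
| "weight (Sub x y z) = 1"
| "weight (Load x a y) = 1"
| "weight (Store a x y) = 1"
| "weight (Seq c d) = weight c + weight d"
| "weight (Cond x c d) = weight c + weight d + 1"
| "weight (While x c) = weight c + 1"

lemma add_le_mult: "2 \<le> (a :: nat) \<Longrightarrow> 2 \<le> b \<Longrightarrow> a + b \<le> a * b"
  by (metis add_le_mono le_add_same_cancel2 mult_2 mult_le_mono1 mult_le_mono2 nat_le_linear order_trans mult.commute)

text \<open>All the powers are at least 3, so sums are bounded by products via
  \<open>a + b \<le> a * b\<close>. Sequencing can then add exponents just as nesting does, and the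
  exponent does not depend on \<open>B\<close>. The second conjunct keeps the induction
  going.\<close>

lemma wcost_le: "wcost B c \<le> (B + 3) ^ weight c \<and> 3 \<le> (B + 3) ^ weight c"
proof (induction c)
  case (Seq c d)
  with add_le_mult[of "(B + 3) ^ weight c" "(B + 3) ^ weight d"] show ?case by (simp add: power_add)
next
  case (Cond x c d)
  let ?m = "(B + 3) ^ weight c * (B + 3) ^ weight d"
  have "wcost B (Cond x c d) \<le> ?m + 1" "3 \<le> ?m"
    using Cond add_le_mult[of "(B + 3) ^ weight c" "(B + 3) ^ weight d"] by simp_all
  then have "wcost B (Cond x c d) \<le> 3 * ?m" "3 \<le> 3 * ?m" by simp_all
  then have "wcost B (Cond x c d) \<le> (B + 3) * ?m \<and> 3 \<le> (B + 3) * ?m"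
    by (meson le_add2 mult_le_mono1 order_trans)
  then show ?case by (simp add: power_add algebra_simps)
next
  case (While x c)
  have "B * (wcost B c + 1) + 1 \<le> B * ((B + 3) ^ weight c + 1) + 1"
    using While by (intro add_mono mult_left_mono) auto
  also have "\<dots> \<le> B * (B + 3) ^ weight c + 3 * (B + 3) ^ weight c"
  proof -
    have "B + 3 \<le> (B + 3) ^ weight c"
      using While by (intro self_le_power) (auto intro: gr0I)
    with While show ?thesis by (simp add: algebra_simps)
  qed
  finally have "wcost B (While x c) \<le> (B + 3) * (B + 3) ^ weight c" by (simp add: algebra_simps)
  moreover have "3 * 1 \<le> (B + 3) * (B + 3) ^ weight c" using While by (intro mult_le_mono) auto
  ultimately show ?case by simp
qed auto

section \<open>Correctness and cost of the compiled code\<close>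

definition runs :: "nat \<Rightarrow> com \<Rightarrow> state \<Rightarrow> state \<Rightarrow> bool" where
  "runs B c s s' \<longleftrightarrow> (\<exists>t. exec c s t s' \<and> t \<le> wcost B c)"

lemma runs_Seq: "runs B c s s' \<Longrightarrow> runs B d s' s'' \<Longrightarrow> runs B (Seq c d) s s''"
  unfolding runs_def by (metis exec.Seq add_mono wcost.simps(7))

lemma runs_atomic:
  "runs B (Const x c) (r, A) (r(x := c), A)"
  "runs B (Add x y z) (r, A) (r(x := r y + r z), A)"
  "runs B (Sub x y z) (r, A) (r(x := r y - r z), A)"
  "runs B (Load x a y) (r, A) (r(x := A a (r y)), A)"
  "runs B (Store a x y) (r, A) (r, A(a := (A a)(r x := r y)))"
  unfolding runs_def using exec.intros(2-6) by fastforce+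

lemma runs_Cond:
  "runs B (if r x \<noteq> 0 then c else d) (r, A) s' \<Longrightarrow> runs B (Cond x c d) (r, A) s'"
proof -
  assume "runs B (if r x \<noteq> 0 then c else d) (r, A) s'"
  then obtain t where "exec (if r x \<noteq> 0 then c else d) (r, A) t s'"
      "t \<le> wcost B (if r x \<noteq> 0 then c else d)" by (auto simp: runs_def)
  moreover from this(1) have "exec (Cond x c d) (r, A) (t + 1) s'"
    using exec.Cond_True[of r x c A t s' d] exec.Cond_False[of r x d A t s' c]
    by (cases "r x = 0") simp_all
  ultimately show ?thesis unfolding runs_def by (auto split: if_splits intro!: exI[of _ "t + 1"])
qed

text \<open>The invariant is indexed by the content of the loop register, the number of rounds still
  to go, so one induction yields termination, cost and correctness.\<close>

lemma runs_While:
  assumes "fst s x = m" "m \<le> B" "I m s"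
    and "\<And>j s. j < m \<Longrightarrow> I (Suc j) s \<Longrightarrow> fst s x = Suc j \<Longrightarrow>
      \<exists>s'. runs B c s s' \<and> fst s' x = j \<and> I j s'"
  shows "\<exists>s'. runs B (While x c) s s' \<and> I 0 s'"
proof -
  have "\<exists>t s'. exec (While x c) s t s' \<and> t \<le> m * (wcost B c + 1) + 1 \<and> I 0 s'"
    using assms(1,3,4)
  proof (induction m arbitrary: s)
    case 0
    obtain r A where "s = (r, A)" by (cases s)
    with 0 show ?case by (auto intro!: exI exec.While_False)
  next
    case (Suc m)
    obtain r A where s: "s = (r, A)" by (cases s)
    obtain s' t where s': "exec c s t s'" "t \<le> wcost B c" "fst s' x = m" "I m s'"
      using Suc.prems(3)[OF _ Suc.prems(2,1)] unfolding runs_def by auto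
    obtain u s'' where "exec (While x c) s' u s''" "u \<le> m * (wcost B c + 1) + 1" "I 0 s''"
      using Suc.IH[OF s'(3,4)] Suc.prems(3) by fastforce
    with s' show ?case
      using exec.While_True[of r x c A t s' u s''] Suc.prems(1) s
      by (intro exI[of _ "t + u + 1"] exI[of _ s'']) auto
  qed
  then obtain t s' where "exec (While x c) s t s'" "t \<le> m * (wcost B c + 1) + 1" "I 0 s'" by blast
  moreover have "m * (wcost B c + 1) \<le> B * (wcost B c + 1)"
    using assms(2) by (rule mult_right_mono) simp
  ultimately show ?thesis unfolding runs_def
    by (intro exI[of _ s'] conjI exI[of _ t]) auto
qed

lemma eval_cong:
  "\<forall>x\<in>evars e. r x = r' x \<Longrightarrow> eval e (r, A) = eval e (r', A)"
proof (induction e arbitrary: r r')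
  case (Plus a b)
  show ?case using Plus.IH[of r r'] Plus.prems by (simp add: ball_Un)
next
  case (Minus a b)
  show ?case using Minus.IH[of r r'] Minus.prems by (simp add: ball_Un)
next
  case (Arr a e)
  show ?case using Arr.IH[of r r'] Arr.prems by (simp add: ball_Un)
next
  case (If g a b)
  show ?case using If.IH[of r r'] If.prems by (simp add: ball_Un)
next
  case (Sum x b e)
  have "eval e (r(x := i), A) = eval e (r'(x := i), A)" for i
    using Sum.prems by (intro Sum.IH) auto
  with Sum.prems show ?case by simp
qed auto

lemma ebounded_cong:
  "\<forall>x\<in>evars e. r x = r' x \<Longrightarrow> ebounded B e (r, A) = ebounded B e (r', A)"
proof (induction e arbitrary: r r')
  case (Plus a b)
  show ?case using Plus.IH[of r r'] Plus.prems by (simp add: ball_Un)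
next
  case (Minus a b)
  show ?case using Minus.IH[of r r'] Minus.prems by (simp add: ball_Un)
next
  case (Arr a e)
  show ?case using Arr.IH[of r r'] Arr.prems by (simp add: ball_Un)
next
  case (If g a b)
  show ?case using If.IH[of r r'] If.prems by (simp add: ball_Un)
next
  case (Sum x b e)
  have "ebounded B e (r(x := i), A) = ebounded B e (r'(x := i), A)" for i
    using Sum.prems by (intro Sum.IH) auto
  with Sum.prems show ?case by simp
qed auto

lemma eval_agree:
  assumes "evars e \<subseteq> {..<d}" "\<forall>x<d. r x = r' x"
  shows "eval e (r, A) = eval e (r', A)" "ebounded B e (r, A) = ebounded B e (r', A)"
  using assms by (auto intro!: eval_cong ebounded_cong)

lemma runs_move: "d \<noteq> x \<Longrightarrow> runs B (Seq (Const d 0) (Add y x d)) (r, A) (r(d := 0, y := r x), A)"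
  by (rule runs_Seq[OF runs_atomic(1)]) (use runs_atomic(2)[of B y x d "r(d := 0)" A] in auto)

lemma sum_lessThan_down: "j < m \<Longrightarrow> f j + (\<Sum>i\<in>{Suc j..<m}. f i) = (\<Sum>i\<in>{j..<m}. f i :: nat)"
  by (simp add: sum.atLeast_Suc_lessThan)

text \<open>Everything below \<open>d\<close> is restored, including summation variables. This is
  why a first operand stored at \<open>d\<close> survives the evaluation of the second one at
  \<open>d + 1\<close>.\<close>

lemma runs_cexp:
  assumes "evars e \<subseteq> {..<d}" "ebounded B e (r, A)"
  shows "\<exists>r'. runs B (cexp e d) (r, A) (r', A) \<and> r' d = eval e (r, A) \<and> (\<forall>x<d. r' x = r x)"
  using assms
proof (induction e arbitrary: d r)
  case (Num c)
  then show ?case by (auto intro!: exI runs_atomic)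
next
  case (Var x)
  have "runs B (cexp (Var x) d) (r, A) (r(d := r x), A)"
    using Var.prems runs_Seq[OF runs_atomic(1)[of B d 0 r A] runs_atomic(2)[of B d d x "r(d := 0)" A]]
    by simp
  then show ?case by (auto intro!: exI)
next
  case (Plus a b)
  obtain r1 where r1: "runs B (cexp a d) (r, A) (r1, A)" "r1 d = eval a (r, A)" "\<forall>x<d. r1 x = r x"
    using Plus.IH(1)[of d r] Plus.prems by auto
  have b: "eval b (r1, A) = eval b (r, A)" "ebounded B b (r1, A)"
    using Plus.prems eval_agree[of b d r1 r] r1(3) by auto
  obtain r2 where r2: "runs B (cexp b (d + 1)) (r1, A) (r2, A)" "r2 (d + 1) = eval b (r1, A)"
      "\<forall>x<d + 1. r2 x = r1 x"
    using Plus.IH(2)[of "d + 1" r1] Plus.prems b by fastforce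
  have "runs B (cexp (Plus a b) d) (r, A) (r2(d := r2 d + r2 (d + 1)), A)"
    by (auto intro!: runs_Seq[OF r1(1)] runs_Seq[OF r2(1)[simplified]] runs_atomic(2)[of B d d "Suc d", simplified])
  then show ?case using r1 r2 b by (auto intro!: exI)
next
  case (Minus a b)
  obtain r1 where r1: "runs B (cexp a d) (r, A) (r1, A)" "r1 d = eval a (r, A)" "\<forall>x<d. r1 x = r x"
    using Minus.IH(1)[of d r] Minus.prems by auto
  have b: "eval b (r1, A) = eval b (r, A)" "ebounded B b (r1, A)"
    using Minus.prems eval_agree[of b d r1 r] r1(3) by auto
  obtain r2 where r2: "runs B (cexp b (d + 1)) (r1, A) (r2, A)" "r2 (d + 1) = eval b (r1, A)"
      "\<forall>x<d + 1. r2 x = r1 x"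
    using Minus.IH(2)[of "d + 1" r1] Minus.prems b by fastforce
  have "runs B (cexp (Minus a b) d) (r, A) (r2(d := r2 d - r2 (d + 1)), A)"
    by (auto intro!: runs_Seq[OF r1(1)] runs_Seq[OF r2(1)[simplified]] runs_atomic(3)[of B d d "Suc d", simplified])
  then show ?case using r1 r2 b by (auto intro!: exI)
next
  case (Arr a e)
  obtain r1 where r1: "runs B (cexp e d) (r, A) (r1, A)" "r1 d = eval e (r, A)" "\<forall>x<d. r1 x = r x"
    using Arr.IH[of d r] Arr.prems by auto
  have "runs B (cexp (Arr a e) d) (r, A) (r1(d := A a (r1 d)), A)"
    by (auto intro!: runs_Seq[OF r1(1)] runs_atomic(4))
  then show ?case using r1 by (auto intro!: exI)
next
  case (If g a b)
  obtain r1 where r1: "runs B (cexp g d) (r, A) (r1, A)" "r1 d = eval g (r, A)" "\<forall>x<d. r1 x = r x"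
    using If.IH(1)[of d r] If.prems by auto
  have ab: "eval a (r1, A) = eval a (r, A)" "ebounded B a (r1, A)"
      "eval b (r1, A) = eval b (r, A)" "ebounded B b (r1, A)"
    using If.prems eval_agree[of a d r1 r] eval_agree[of b d r1 r] r1(3) by auto
  let ?c = "if r1 d \<noteq> 0 then a else b"
  obtain r2 where r2: "runs B (cexp ?c d) (r1, A) (r2, A)" "r2 d = eval ?c (r1, A)"
      "\<forall>x<d. r2 x = r1 x"
    using If.IH(2)[of d r1] If.IH(3)[of d r1] If.prems ab by (cases "r1 d = 0") auto
  have "runs B (cexp (If g a b) d) (r, A) (r2, A)"
    using r2(1) by (auto intro!: runs_Seq[OF r1(1)] runs_Cond split: if_splits)
  then show ?case using r1 r2 ab by (auto intro!: exI)
next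
  case (Sum x b e)
  let ?f = "\<lambda>i. eval e (r(x := i), A)"
  let ?body = "Seq (Const (d + 3) 1) (Seq (Sub (d + 1) (d + 1) (d + 3))
       (Seq (Const (d + 3) 0) (Seq (Add x (d + 1) (d + 3))
       (Seq (cexp e (d + 3)) (Add d d (d + 3))))))"
  \<comment> \<open>The compiled sum counts down, so with \<open>j\<close> rounds left the terms
    with index at least \<open>j\<close> have been added. Meanwhile \<open>x\<close> is exempt from
    the frame condition, its old value being saved at \<open>d + 2\<close>.\<close>
  define I where "I j s \<longleftrightarrow> snd s = A \<and> fst s (d + 2) = r x \<and>
    fst s d = (\<Sum>i\<in>{j..<r b}. ?f i) \<and> (\<forall>y<d. y \<noteq> x \<longrightarrow> fst s y = r y)" for j and s :: state
  have xb: "x < d" "b < d" "evars e \<subseteq> {..<d + 3}" using Sum.prems by auto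
  let ?r0 = "r(d := 0, d + 1 := r b, d + 2 := r x)"
  have init: "runs B (Const d 0) (r, A) (r(d := 0), A)"
    "runs B (Add (d + 1) d b) (r(d := 0), A) (r(d := 0, d + 1 := r b), A)"
    "runs B (Add (d + 2) d x) (r(d := 0, d + 1 := r b), A) (?r0, A)"
    using xb runs_atomic(1)[of B d 0 r A] runs_atomic(2)[of B "d + 1" d b "r(d := 0)" A]
      runs_atomic(2)[of B "d + 2" d x "r(d := 0, d + 1 := r b)" A] by auto
  have "\<exists>s'. runs B (While (d + 1) ?body) (?r0, A) s' \<and> I 0 s'"
  proof (rule runs_While)
    fix j and s :: state
    assume j: "j < r b" and I: "I (Suc j) s" and sj: "fst s (d + 1) = Suc j"
    obtain r1 where s: "s = (r1, A)" using I by (cases s) (auto simp: I_def)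
    let ?r2 = "r1(d + 3 := 0, d + 1 := j, x := j)"
    have agree: "\<forall>y\<in>evars e. ?r2 y = (r(x := j)) y"
      using I s xb Sum.prems by (auto simp: I_def)
    have "ebounded B e (?r2, A)"
      unfolding ebounded_cong[OF agree] using Sum.prems j by simp
    from Sum.IH[OF xb(3) this, unfolded eval_cong[OF agree]] obtain r3 where r3: "runs B (cexp e (d + 3)) (?r2, A) (r3, A)"
      "r3 (d + 3) = ?f j" "\<forall>y<d + 3. r3 y = ?r2 y"
      by blast
    have "runs B (Const (d + 3) 1) (r1, A) (r1(d + 3 := 1), A)"
      "runs B (Sub (d + 1) (d + 1) (d + 3)) (r1(d + 3 := 1), A) (r1(d + 3 := 1, d + 1 := j), A)"
      "runs B (Const (d + 3) 0) (r1(d + 3 := 1, d + 1 := j), A) (r1(d + 3 := 0, d + 1 := j), A)"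
      "runs B (Add x (d + 1) (d + 3)) (r1(d + 3 := 0, d + 1 := j), A) (?r2, A)"
      "runs B (Add d d (d + 3)) (r3, A) (r3(d := r3 d + r3 (d + 3)), A)"
      using runs_atomic(1)[of B "d + 3" 1 r1 A]
        runs_atomic(3)[of B "d + 1" "d + 1" "d + 3" "r1(d + 3 := 1)" A]
        runs_atomic(1)[of B "d + 3" 0 "r1(d + 3 := 1, d + 1 := j)" A]
        runs_atomic(2)[of B x "d + 1" "d + 3" "r1(d + 3 := 0, d + 1 := j)" A]
        runs_atomic(2)[of B d d "d + 3" r3 A] s sj by (auto simp: fun_upd_twist)
    then have "runs B ?body s (r3(d := r3 d + r3 (d + 3)), A)"
      unfolding s using r3(1) runs_Seq by meson
    moreover have "I j (r3(d := r3 d + r3 (d + 3)), A)"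
      using r3 I s xb j by (auto simp: I_def sum_lessThan_down[symmetric] simp del: sum.op_ivl_Suc)
    ultimately show "\<exists>s'. runs B ?body s s' \<and> fst s' (d + 1) = j \<and> I j s'"
      using r3 xb by (intro exI[of _ "(r3(d := r3 d + r3 (d + 3)), A)"]) auto
  qed (use Sum.prems xb in \<open>auto simp: I_def\<close>)
  then obtain r1 where r1: "runs B (While (d + 1) ?body) (?r0, A) (r1, A)" "I 0 (r1, A)"
    by (auto simp: I_def)
  let ?r2 = "r1(d + 3 := 0, x := r1 (d + 2))"
  have fin: "runs B (Seq (Const (d + 3) 0) (Add x (d + 2) (d + 3))) (r1, A) (?r2, A)"
    by (rule runs_move) simp
  have run: "runs B (cexp (Sum x b e) d) (r, A) (?r2, A)"
    unfolding cexp.simps by (intro runs_Seq[OF init(1)] runs_Seq[OF init(2)] runs_Seq[OF init(3)]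
      runs_Seq[OF r1(1)] fin)
  have "?r2 d = eval (Sum x b e) (r, A)" "\<forall>y<d. ?r2 y = r y"
    using r1(2) xb by (auto simp: I_def lessThan_atLeast0)
  with run show ?case by blast
qed

text \<open>Machine and source states agree only below \<open>v\<close>, since the compiled code
  leaves garbage on the stack; hence the two register files \<open>r\<close> and
  \<open>r\<^sub>0\<close>. The last conjunct protects the counters of the enclosing loops, which
  lie between \<open>v\<close> and \<open>d\<close>.\<close>

lemma runs_cstmt:
  assumes "vars p \<subseteq> {..<v}" "v \<le> d" "\<forall>x<v. r x = r\<^sub>0 x" "bounded B p (r\<^sub>0, A)"
  shows "\<exists>r'. runs B (cstmt p d) (r, A) (r', snd (sem p (r\<^sub>0, A))) \<and>
    (\<forall>x<v. r' x = fst (sem p (r\<^sub>0, A)) x) \<and> (\<forall>x. v \<le> x \<and> x < d \<longrightarrow> r' x = r x)"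
  using assms
proof (induction p arbitrary: d r r\<^sub>0 A)
  case (Assign x e)
  have e: "eval e (r, A) = eval e (r\<^sub>0, A)" "ebounded B e (r, A)"
    using Assign.prems eval_agree[of e v r r\<^sub>0] by auto
  obtain r1 where r1: "runs B (cexp e d) (r, A) (r1, A)" "r1 d = eval e (r, A)" "\<forall>x<d. r1 x = r x"
    using runs_cexp[OF _ e(2), of d] Assign.prems by fastforce
  define r2 where "r2 = r1(d + 1 := 0, x := r1 d)"
  have "runs B (cstmt (Assign x e) d) (r, A) (r2, A)"
    unfolding cstmt.simps r2_def by (rule runs_Seq[OF r1(1) runs_move]) simp
  moreover have "\<forall>y<v. r2 y = fst (sem (Assign x e) (r\<^sub>0, A)) y" "\<forall>y. v \<le> y \<and> y < d \<longrightarrow> r2 y = r y"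
    using r1(2,3) e Assign.prems by (auto simp: r2_def)
  ultimately show ?case by auto
next
  case (Upd a i e)
  have e: "eval e (r, A) = eval e (r\<^sub>0, A)" "ebounded B e (r, A)"
      "eval i (r, A) = eval i (r\<^sub>0, A)" "ebounded B i (r, A)"
    using Upd.prems eval_agree[of e v r r\<^sub>0] eval_agree[of i v r r\<^sub>0] by auto
  obtain r1 where r1: "runs B (cexp i d) (r, A) (r1, A)" "r1 d = eval i (r, A)" "\<forall>x<d. r1 x = r x"
    using runs_cexp[OF _ e(4), of d] Upd.prems by fastforce
  have e1: "eval e (r1, A) = eval e (r, A)" "ebounded B e (r1, A)"
    using eval_agree[of e v r1 r] Upd.prems r1(3) e by auto
  obtain r2 where r2: "runs B (cexp e (d + 1)) (r1, A) (r2, A)" "r2 (d + 1) = eval e (r1, A)"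
      "\<forall>x<d + 1. r2 x = r1 x"
    using runs_cexp[OF _ e1(2), of "d + 1"] Upd.prems by fastforce
  have "runs B (cstmt (Upd a i e) d) (r, A) (r2, A(a := (A a)(r2 d := r2 (d + 1))))"
    unfolding cstmt.simps by (rule runs_Seq[OF r1(1) runs_Seq[OF r2(1) runs_atomic(5)]])
  moreover have "A(a := (A a)(r2 d := r2 (d + 1))) = snd (sem (Upd a i e) (r\<^sub>0, A))"
    using r1(2) r2 e e1 by simp
  moreover have "\<forall>y<v. r2 y = fst (sem (Upd a i e) (r\<^sub>0, A)) y" "\<forall>y. v \<le> y \<and> y < d \<longrightarrow> r2 y = r y"
    using r1(3) r2(3) Upd.prems by auto
  ultimately show ?case by metis
next
  case (Then p q)
  obtain r1 where r1: "runs B (cstmt p d) (r, A) (r1, snd (sem p (r\<^sub>0, A)))"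
      "\<forall>x<v. r1 x = fst (sem p (r\<^sub>0, A)) x" "\<forall>x. v \<le> x \<and> x < d \<longrightarrow> r1 x = r x"
    using Then.IH(1)[of d r r\<^sub>0 A] Then.prems by auto
  obtain r2 where r2: "runs B (cstmt q d) (r1, snd (sem p (r\<^sub>0, A))) (r2, snd (sem q (sem p (r\<^sub>0, A))))"
      "\<forall>x<v. r2 x = fst (sem q (sem p (r\<^sub>0, A))) x" "\<forall>x. v \<le> x \<and> x < d \<longrightarrow> r2 x = r1 x"
    using Then.IH(2)[of d r1 "fst (sem p (r\<^sub>0, A))" "snd (sem p (r\<^sub>0, A))"] Then.prems r1 by auto
  show ?case using runs_Seq[OF r1(1) r2(1)] r1(3) r2(2,3) by auto
next
  case (For x b p)
  let ?body = "Seq (Const (d + 2) 0) (Seq (Add x d (d + 2))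
       (Seq (cstmt p (d + 2))
       (Seq (Const (d + 2) 1) (Seq (Sub (d + 1) (d + 1) (d + 2)) (Add d d (d + 2))))))"
  define h where "h = (\<lambda>i. iter (\<lambda>i t. sem p (set_reg x i t)) i (r\<^sub>0, A))"
  have h: "h 0 = (r\<^sub>0, A)" "h (Suc i) = sem p (set_reg x i (h i))" for i by (simp_all add: h_def)
  let ?n = "r\<^sub>0 b"
  \<comment> \<open>With \<open>j\<close> rounds left, \<open>?n - j\<close> rounds of the source
    loop are done, which is also the value of the counter at \<open>d\<close>.\<close>
  define I where "I j s \<longleftrightarrow> snd s = snd (h (?n - j)) \<and> fst s d = ?n - j \<and>
    (\<forall>y<v. fst s y = fst (h (?n - j)) y) \<and> (\<forall>y. v \<le> y \<and> y < d \<longrightarrow> fst s y = r y)" for j and s :: state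
  have xb: "x < v" "b < v" "v \<le> d" "vars p \<subseteq> {..<v}" using For.prems by auto
  let ?r0 = "r(d := 0, d + 1 := r b)"
  have init: "runs B (Const d 0) (r, A) (r(d := 0), A)"
    "runs B (Add (d + 1) d b) (r(d := 0), A) (?r0, A)"
    using xb runs_atomic(1)[of B d 0 r A] runs_atomic(2)[of B "d + 1" d b "r(d := 0)" A] by auto
  have "\<exists>s'. runs B (While (d + 1) ?body) (?r0, A) s' \<and> I 0 s'"
  proof (rule runs_While)
    fix j and s :: state
    assume j: "j < r\<^sub>0 b" and I: "I (Suc j) s" and sj: "fst s (d + 1) = Suc j"
    define i where "i = ?n - Suc j"
    have ij: "i < ?n" "?n - j = Suc i" using j by (auto simp: i_def)
    obtain r1 A1 where s: "s = (r1, A1)" by (cases s)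
    obtain rh where rh: "h i = (rh, A1)" using I s by (cases "h i") (auto simp: I_def i_def)
    have r1: "r1 d = i" "\<forall>y<v. r1 y = rh y" "r1 (d + 1) = Suc j"
      "\<forall>y. v \<le> y \<and> y < d \<longrightarrow> r1 y = r y"
      using I s sj by (auto simp: I_def rh[unfolded i_def] i_def)
    let ?r2 = "r1(d + 2 := 0, x := i)"
    have bd: "bounded B p (rh(x := i), A1)" using For.prems(4) ij rh by (auto simp: h_def)
    obtain r3 where r3: "runs B (cstmt p (d + 2)) (?r2, A1) (r3, snd (h (Suc i)))"
      "\<forall>y<v. r3 y = fst (h (Suc i)) y" "\<forall>y. v \<le> y \<and> y < d + 2 \<longrightarrow> r3 y = ?r2 y"
    proof -
      have "\<forall>y<v. ?r2 y = (rh(x := i)) y" "v \<le> d + 2" using r1(2) xb by auto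
      from For.IH[OF xb(4) this(2,1) bd]
      obtain r3 where "runs B (cstmt p (d + 2)) (?r2, A1) (r3, snd (sem p (rh(x := i), A1)))"
        "\<forall>y<v. r3 y = fst (sem p (rh(x := i), A1)) y" "\<forall>y. v \<le> y \<and> y < d + 2 \<longrightarrow> r3 y = ?r2 y"
        by blast
      moreover have "h (Suc i) = sem p (rh(x := i), A1)" using h(2)[of i] rh by simp
      ultimately show ?thesis using that[of r3] by simp
    qed
    have r3d: "r3 d = i" "r3 (d + 1) = Suc j" using r3(3) xb r1 by auto
    let ?A = "snd (h (Suc i))"
    let ?r4 = "r3(d + 2 := 1, d + 1 := j, d := Suc i)"
    have "runs B (Seq (Const (d + 2) 0) (Add x d (d + 2))) (r1, A1) (?r2, A1)"
      using runs_move[of "d + 2" d B x r1 A1] r1 by simp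
    then have "runs B (Const (d + 2) 0) (r1, A1) (r1(d + 2 := 0), A1)"
      "runs B (Add x d (d + 2)) (r1(d + 2 := 0), A1) (?r2, A1)"
      using runs_atomic(1)[of B "d + 2" 0 r1 A1] runs_atomic(2)[of B x d "d + 2" "r1(d + 2 := 0)" A1] r1
      by auto
    moreover have "runs B (Const (d + 2) 1) (r3, ?A) (r3(d + 2 := 1), ?A)"
      "runs B (Sub (d + 1) (d + 1) (d + 2)) (r3(d + 2 := 1), ?A) (r3(d + 2 := 1, d + 1 := j), ?A)"
      "runs B (Add d d (d + 2)) (r3(d + 2 := 1, d + 1 := j), ?A) (?r4, ?A)"
      using runs_atomic(1)[of B "d + 2" 1 r3 ?A]
        runs_atomic(3)[of B "d + 1" "d + 1" "d + 2" "r3(d + 2 := 1)" ?A]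
        runs_atomic(2)[of B d d "d + 2" "r3(d + 2 := 1, d + 1 := j)" ?A] r3d by auto
    ultimately have "runs B ?body s (?r4, ?A)"
      unfolding s using r3(1) runs_Seq by meson
    moreover have "I j (?r4, ?A)" using r3 ij r1 xb by (auto simp: I_def)
    ultimately show "\<exists>s'. runs B ?body s s' \<and> fst s' (d + 1) = j \<and> I j s'"
      by (intro exI[of _ "(?r4, ?A)"]) auto
  qed (use For.prems xb in \<open>auto simp: I_def h\<close>)
  then obtain r1 A1 where r1: "runs B (While (d + 1) ?body) (?r0, A) (r1, A1)" "I 0 (r1, A1)"
    by (metis surj_pair)
  have "runs B (cstmt (For x b p) d) (r, A) (r1, A1)"
    unfolding cstmt.simps by (intro runs_Seq[OF init(1)] runs_Seq[OF init(2)] r1(1))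
  then show ?case using r1(2) unfolding I_def h_def by auto
qed

section \<open>Solutions with few arcs\<close>

text \<open>Walks in this relation may end at \<open>v\<close> but cannot pass through it, so it
  expresses the part of a walk up to its first visit of \<open>v\<close> as well as the part after
  its last one.\<close>

definition no_exit :: "('a \<times> 'a) set \<Rightarrow> 'a \<Rightarrow> ('a \<times> 'a) set" where
  "no_exit F v = {e \<in> F. fst e \<noteq> v}"

lemma no_exit_rtrancl_subset: "(x, y) \<in> (no_exit F v)\<^sup>* \<Longrightarrow> (x, y) \<in> F\<^sup>*"
  by (rule rtrancl_mono[THEN subsetD]) (auto simp: no_exit_def)

lemma rtrancl_first_visit:
  "(s, t) \<in> F\<^sup>* \<Longrightarrow> (s, t) \<in> (no_exit F v)\<^sup>* \<or> (s, v) \<in> (no_exit F v)\<^sup>* \<and> (v, t) \<in> F\<^sup>*"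
proof (induction rule: rtrancl_induct)
  case (step y z)
  show ?case
  proof (cases "y = v")
    case True
    with step show ?thesis by (auto dest: no_exit_rtrancl_subset)
  next
    case False
    with step.hyps have "(y, z) \<in> no_exit F v" by (simp add: no_exit_def)
    with step.IH step.hyps show ?thesis by (meson rtrancl.rtrancl_into_rtrancl)
  qed
qed simp

lemma rtrancl_last_visit:
  "(s, t) \<in> F\<^sup>* \<Longrightarrow> (s, t) \<in> (no_exit F v)\<^sup>* \<or> (\<exists>w. (v, w) \<in> F \<and> (w, t) \<in> (no_exit F v)\<^sup>*)"
proof (induction rule: rtrancl_induct)
  case (step y z)
  show ?case
  proof (cases "y = v")
    case True
    with step show ?thesis by auto
  next
    case False
    with step.hyps have "(y, z) \<in> no_exit F v" by (simp add: no_exit_def)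
    with step.IH step.hyps show ?thesis by (meson rtrancl.rtrancl_into_rtrancl)
  qed
qed simp

text \<open>\<open>R\<close> will be the reflexive transitive closure of the input digraph. Its
  transitivity supplies the new arcs in the exchange arguments.\<close>

locale routing =
  fixes V :: "'a set" and R :: "('a \<times> 'a) set" and T :: nat and K :: "('a \<times> 'a) set"
  assumes finite_V: "finite V" and R_subset: "R \<subseteq> V \<times> V" and K_subset: "K \<subseteq> V \<times> V"
    and trans_R: "trans R" and refl_R: "\<And>v. v \<in> V \<Longrightarrow> (v, v) \<in> R"
begin

definition solution :: "('a \<times> 'a) set \<Rightarrow> bool" where
  "solution F \<longleftrightarrow> F \<subseteq> R \<and> (\<forall>v. card (F `` {v}) \<le> T) \<and> K \<subseteq> F\<^sup>*"

lemma rtrancl_subset_R: "F \<subseteq> R \<Longrightarrow> (x, y) \<in> F\<^sup>* \<Longrightarrow> x \<in> V \<Longrightarrow> (x, y) \<in> R"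
proof -
  assume "F \<subseteq> R" "(x, y) \<in> F\<^sup>*" "x \<in> V"
  then have "(x, y) \<in> R\<^sup>*" using rtrancl_mono by blast
  then show ?thesis using refl_R[OF \<open>x \<in> V\<close>] trans_R by (metis rtranclD trancl_id)
qed

lemma finite_K: "finite K"
  using K_subset finite_V finite_subset by blast

end

locale min_routing = routing +
  fixes F :: "('a \<times> 'a) set"
  assumes sol: "solution F" and minimal: "\<And>F'. solution F' \<Longrightarrow> card F \<le> card F'"
begin

lemma F_R: "F \<subseteq> R" and degree: "card (F `` {v}) \<le> T" and routes: "(s, t) \<in> K \<Longrightarrow> (s, t) \<in> F\<^sup>*"
  using sol unfolding solution_def by blast+

lemma finite_F: "finite F"
  by (rule finite_subset[OF subset_trans[OF F_R R_subset]]) (simp add: finite_V)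

lemma finite_out: "finite (F `` {v})"
  using finite_F by (rule finite_Image)

definition bridge :: "'a \<Rightarrow> 'a \<Rightarrow> 'a \<Rightarrow> 'a \<Rightarrow> bool" where
  "bridge v w s t \<longleftrightarrow> (v, w) \<in> F \<and> (s, t) \<in> K \<and> (s, t) \<notin> (F - {(v, w)})\<^sup>*"

text \<open>Deleting an arc raises no outdegree, so by minimality it must disconnect some
  commodity.\<close>

lemma ex_bridge:
  assumes "(v, w) \<in> F"
  shows "\<exists>s t. bridge v w s t"
proof (rule ccontr)
  assume "\<not> ?thesis"
  then have "K \<subseteq> (F - {(v, w)})\<^sup>*" using assms by (auto simp: bridge_def)
  moreover have "card ((F - {(v, w)}) `` {x}) \<le> T" for x
    by (rule order_trans[OF card_mono degree[of x]]) (auto intro: finite_out)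
  ultimately have "solution (F - {(v, w)})" using F_R by (auto simp: solution_def)
  from minimal[OF this] show False
    using assms finite_F by (metis card_Diff1_less leD)
qed

lemma no_exit_avoids: "(x, y) \<in> (no_exit F v)\<^sup>* \<Longrightarrow> (x, y) \<in> (F - {(v, w)})\<^sup>*"
  by (rule rtrancl_mono[THEN subsetD]) (auto simp: no_exit_def)

text \<open>A route of the commodity is cut at its first and last visit of \<open>v\<close>. Leaving
  \<open>v\<close> by another arc and reaching \<open>t\<close> without leaving \<open>v\<close>
  again would give a route that avoids \<open>(v, w)\<close>; hence \<open>w\<close> is the only
  exit of \<open>v\<close> towards \<open>t\<close> in this sense.\<close>

lemma bridgeD:
  assumes "bridge v w s t"
  shows "(s, v) \<in> (no_exit F v)\<^sup>*" "(w, t) \<in> (no_exit F v)\<^sup>*" "(s, t) \<notin> (no_exit F v)\<^sup>*"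
    and "\<And>x. (v, x) \<in> F \<Longrightarrow> (x, t) \<in> (no_exit F v)\<^sup>* \<Longrightarrow> x = w"
proof -
  have st: "(s, t) \<in> F\<^sup>*" "(s, t) \<notin> (F - {(v, w)})\<^sup>*"
    using assms routes by (auto simp: bridge_def)
  show "(s, t) \<notin> (no_exit F v)\<^sup>*" using st(2) no_exit_avoids by blast
  then show sv: "(s, v) \<in> (no_exit F v)\<^sup>*" using rtrancl_first_visit[OF st(1)] by blast
  show uniq: "x = w" if "(v, x) \<in> F" "(x, t) \<in> (no_exit F v)\<^sup>*" for x
  proof (rule ccontr)
    assume "x \<noteq> w"
    then have "(v, x) \<in> F - {(v, w)}" using that by simp
    then have "(s, t) \<in> (F - {(v, w)})\<^sup>*"
      using no_exit_avoids[OF sv] no_exit_avoids[OF that(2)] by (meson converse_rtrancl_into_rtrancl rtrancl_trans)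
    with st(2) show False ..
  qed
  show "(w, t) \<in> (no_exit F v)\<^sup>*"
    using rtrancl_last_visit[OF st(1), of v] \<open>(s, t) \<notin> (no_exit F v)\<^sup>*\<close> uniq by blast
qed

text \<open>The order of indispensable arcs along the routes to \<open>t\<close>: \<open>v'\<close>
  lies behind the arc \<open>(v, w)\<close>. Both segments must not leave \<open>v\<close> again, so
  that the uniqueness of the exit applies to them.\<close>

definition before :: "'a \<Rightarrow> 'a \<Rightarrow> 'a \<Rightarrow> 'a \<Rightarrow> bool" where
  "before t v w v' \<longleftrightarrow> (w, v') \<in> (no_exit F v)\<^sup>* \<and> (v', t) \<in> (no_exit F v)\<^sup>*"

text \<open>Follow a route from \<open>w\<close> to \<open>t\<close> that never leaves
  \<open>v\<close>. If it visits \<open>v'\<close>, the first alternative holds. Otherwise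
  \<open>v\<close> reaches \<open>t\<close> without leaving \<open>v'\<close>; as \<open>v'\<close>
  is indispensable, \<open>s\<close> cannot reach \<open>v\<close> without leaving
  \<open>v'\<close>, and the last exit from \<open>v'\<close> on the way to \<open>v\<close> must be
  \<open>w'\<close>.\<close>

lemma before_total:
  assumes "bridge v w s t" "bridge v' w' s t" "v \<noteq> v'"
  shows "before t v w v' \<or> before t v' w' v"
proof -
  have "(w, t) \<in> (no_exit (no_exit F v) v')\<^sup>* \<or>
      (w, v') \<in> (no_exit (no_exit F v) v')\<^sup>* \<and> (v', t) \<in> (no_exit F v)\<^sup>*"
    using rtrancl_first_visit[OF bridgeD(2)[OF assms(1)]] .
  then show ?thesis
  proof
    assume "(w, v') \<in> (no_exit (no_exit F v) v')\<^sup>* \<and> (v', t) \<in> (no_exit F v)\<^sup>*"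
    then show ?thesis by (auto simp: before_def dest: no_exit_rtrancl_subset)
  next
    assume "(w, t) \<in> (no_exit (no_exit F v) v')\<^sup>*"
    then have "(w, t) \<in> (no_exit F v')\<^sup>*"
      by (rule rtrancl_mono[THEN subsetD, rotated]) (auto simp: no_exit_def)
    moreover have "(v, w) \<in> no_exit F v'" using assms by (auto simp: bridge_def no_exit_def)
    ultimately have vt: "(v, t) \<in> (no_exit F v')\<^sup>*" by (meson converse_rtrancl_into_rtrancl)
    have "(s, v) \<in> F\<^sup>*" using bridgeD(1)[OF assms(1)] by (rule no_exit_rtrancl_subset)
    from rtrancl_last_visit[OF this, of v'] consider "(s, v) \<in> (no_exit F v')\<^sup>*"
      | x where "(v', x) \<in> F" "(x, v) \<in> (no_exit F v')\<^sup>*" by blast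
    then show ?thesis
    proof cases
      case 1
      with vt bridgeD(3)[OF assms(2)] show ?thesis by (meson rtrancl_trans)
    next
      case 2
      then have "x = w'" using bridgeD(4)[OF assms(2) 2(1)] vt by (meson rtrancl_trans)
      with 2 vt show ?thesis by (simp add: before_def)
    qed
  qed
qed

text \<open>Otherwise \<open>b\<close> leads to \<open>v'\<close> and on to \<open>t\<close> without
  leaving \<open>v\<close> again, although \<open>a\<close> is the only exit of \<open>v\<close>
  with this property.\<close>

lemma not_same_order:
  assumes "bridge v a s t" "bridge v b s' t'" "a \<noteq> b" "before t v a v'" "before t' v b v'"
  shows False
proof -
  have "(b, t) \<in> (no_exit F v)\<^sup>*"
    using assms(4,5) unfolding before_def by (meson rtrancl_trans)
  then show False using bridgeD(4)[OF assms(1), of b] assms(2,3) by (auto simp: bridge_def)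
qed

lemma before_rtrancl:
  assumes "bridge v w s t" "before t v w v'"
  shows "(w, v') \<in> F\<^sup>*" "(v, v') \<in> F\<^sup>*"
proof -
  show "(w, v') \<in> F\<^sup>*" using assms(2) by (auto simp: before_def dest: no_exit_rtrancl_subset)
  then show "(v, v') \<in> F\<^sup>*" using assms(1) unfolding bridge_def by (meson converse_rtrancl_into_rtrancl)
qed

text \<open>Otherwise replacing the arcs inside the strong component of \<open>v\<close> by a Hamiltonian cycle
  would save an arc.\<close>

lemma one_arc_in_component:
  assumes "(v, a) \<in> F" "(v, b) \<in> F" "a \<noteq> b" "(a, v) \<in> F\<^sup>*" "(b, v) \<in> F\<^sup>*"
  shows False
proof -
  define S where "S = {x. (x, v) \<in> F\<^sup>* \<and> (v, x) \<in> F\<^sup>*}"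
  define m where "m = card S"
  have inV: "v \<in> V" using assms(1) F_R R_subset by auto
  have S_R: "(x, y) \<in> R" if "x \<in> S" "y \<in> S" for x y
  proof -
    have "x \<in> V" using that(1) rtrancl_subset_R[OF F_R _ inV] R_subset by (auto simp: S_def)
    moreover have "(x, y) \<in> F\<^sup>*" using that by (auto simp: S_def)
    ultimately show ?thesis using rtrancl_subset_R[OF F_R] by blast
  qed
  have S_V: "S \<subseteq> V" using S_R R_subset by blast
  then have fin: "finite S" using finite_V finite_subset by blast
  have abv: "v \<in> S" "a \<in> S" "b \<in> S" using assms by (auto simp: S_def)
  have m: "0 < m" using abv(1) fin by (auto simp: m_def card_gt_0_iff)
  have "\<exists>y. (x, y) \<in> F \<and> y \<in> S" if x: "x \<in> S" for x
  proof (cases "x = v")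
    case False
    have "(x, v) \<in> F\<^sup>*" using x by (simp add: S_def)
    then obtain y where "(x, y) \<in> F" "(y, v) \<in> F\<^sup>*" using False by (meson converse_rtranclE)
    moreover from this(1) have "(v, y) \<in> F\<^sup>*" using x by (auto simp: S_def)
    ultimately show ?thesis by (auto simp: S_def)
  qed (use assms abv in auto)
  then obtain g0 where g0: "\<And>x. x \<in> S \<Longrightarrow> (x, g0 x) \<in> F \<and> g0 x \<in> S" by metis
  \<comment> \<open>Every member of the component keeps one arc inside it. At \<open>v\<close> this
    arc is fixed to be the one to \<open>a\<close>, so that \<open>(v, b)\<close> is left over as an
    additional arc.\<close>
  define g where "g = g0(v := a)"
  have g: "(x, g x) \<in> F \<and> g x \<in> S" if "x \<in> S" for x using g0[OF that] assms abv by (auto simp: g_def)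
  obtain h where h: "bij_betw h {0..<m} S" using ex_bij_betw_nat_finite[OF fin] by (auto simp: m_def)
  have hS: "h i \<in> S" if "i < m" for i using h that by (auto simp: bij_betw_def)
  define C where "C = (\<lambda>i. (h i, h (Suc i mod m))) ` {0..<m}"
  have C_S: "C \<subseteq> S \<times> S" using m hS by (auto simp: C_def)
  define E where "E = F \<inter> S \<times> S"
  let ?F = "(F - E) \<union> C"
  have C_reach: "(h i, h ((i + n) mod m)) \<in> C\<^sup>*" if "i < m" for i n
  proof (induction n)
    case 0
    with that show ?case by simp
  next
    case (Suc n)
    have "(h ((i + n) mod m), h (Suc ((i + n) mod m) mod m)) \<in> C" using m by (auto simp: C_def)
    then have "(h ((i + n) mod m), h ((i + Suc n) mod m)) \<in> C" by (simp add: mod_Suc_eq)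
    with Suc show ?case by simp
  qed
  have S_reach: "(x, y) \<in> C\<^sup>*" if xy: "x \<in> S" "y \<in> S" for x y
  proof -
    have "x \<in> h ` {0..<m}" "y \<in> h ` {0..<m}" using xy h by (auto simp: bij_betw_def)
    then obtain i j where "x = h i" "i < m" "y = h j" "j < m" by auto
    with C_reach[of i "m - i + j"] show ?thesis by simp
  qed
  have "F \<subseteq> ?F\<^sup>*"
  proof
    fix e assume e: "e \<in> F"
    show "e \<in> ?F\<^sup>*"
    proof (cases "e \<in> E")
      case True
      then have "e \<in> C\<^sup>*" using S_reach by (auto simp: E_def)
      then show ?thesis using rtrancl_mono[of C ?F] by auto
    next
      case False
      with e show ?thesis by auto
    qed
  qed
  then have "F\<^sup>* \<subseteq> ?F\<^sup>*" by (simp add: rtrancl_subset_rtrancl)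
  moreover have "?F \<subseteq> R" using F_R C_S S_R by blast
  moreover have "card (?F `` {x}) \<le> T" for x
  proof (cases "x \<in> S")
    case True
    then obtain i where i: "x = h i" "i < m" using h by (auto simp: bij_betw_def)
    have inj: "inj_on h {0..<m}" using h by (simp add: bij_betw_def)
    \<comment> \<open>A vertex of the component gives up its arcs inside, among them
      \<open>(x, g x)\<close>, for a single arc of the cycle, so its outdegree does not
      grow.\<close>
    have "?F `` {x} \<subseteq> insert (h (Suc i mod m)) (F `` {x} - S)"
      using True i inj by (auto simp: C_def E_def inj_on_def)
    then have "card (?F `` {x}) \<le> card (insert (h (Suc i mod m)) (F `` {x} - S))"
      by (rule card_mono[rotated]) (simp add: finite_out)
    also have "\<dots> \<le> Suc (card (F `` {x} - S))" by (rule card_insert_le_m1) (simp_all add: finite_out)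
    also have "\<dots> \<le> card (F `` {x})"
    proof -
      have "F `` {x} - S \<subset> F `` {x}" using g[OF True] by blast
      then show ?thesis using psubset_card_mono[OF finite_out] by (metis Suc_leI)
    qed
    finally show ?thesis using degree order_trans by blast
  next
    case False
    then have "?F `` {x} \<subseteq> F `` {x}" using C_S by auto
    then show ?thesis using degree card_mono[OF finite_out] order_trans by blast
  qed
  ultimately have "solution ?F" using sol by (auto simp: solution_def)
  from minimal[OF this] have le: "card F \<le> card (F - E) + card C"
    using card_Un_le order_trans by blast
  have C_m: "card C \<le> m" unfolding C_def by (rule order_trans[OF card_image_le]) simp_all
  have diff: "card (F - E) = card F - card E"
    by (rule card_Diff_subset) (auto simp: E_def intro: finite_subset[OF _ finite_F])
  have E_F: "card E \<le> card F" by (rule card_mono[OF finite_F]) (simp add: E_def)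
  \<comment> \<open>The \<open>m\<close> arcs \<open>(x, g x)\<close> and the arc
    \<open>(v, b)\<close> lie inside the component, whereas the cycle has at most \<open>m\<close>
    arcs.\<close>
  have "Suc m = card (insert (v, b) ((\<lambda>x. (x, g x)) ` S))"
    using fin assms(3) by (subst card_insert_disjoint) (auto simp: m_def g_def card_image inj_on_def)
  also have "\<dots> \<le> card E"
    by (rule card_mono) (use g assms abv finite_F in \<open>auto simp: E_def\<close>)
  finally show False using le C_m diff E_F by linarith
qed

text \<open>On \<open>X\<close> the order \<open>P\<close> for the first commodity is a tournament
  and the order \<open>Q\<close> for the second is its reverse. Among three vertices some
  \<open>v\<close> is the middle of a path \<open>u\<close>, \<open>v\<close>, \<open>w\<close> of
  \<open>P\<close>. It can return to itself through \<open>a v\<close> and \<open>w\<close>, and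
  also through \<open>b v\<close> and \<open>u\<close>, so it has two arcs inside its strong
  component.\<close>

lemma no_three_branchings:
  assumes "\<And>v. v \<in> X \<Longrightarrow> bridge v (a v) s t \<and> bridge v (b v) s' t' \<and> a v \<noteq> b v"
    and "{x, y, z} \<subseteq> X" "x \<noteq> y" "y \<noteq> z" "x \<noteq> z"
  shows False
proof -
  define P where "P u v = before t u (a u) v" for u v
  define Q where "Q u v = before t' u (b u) v" for u v
  have PQ: "(P u v \<or> P v u) \<and> (Q u v \<or> Q v u) \<and> \<not> (P u v \<and> Q u v)"
    if "u \<in> X" "v \<in> X" "u \<noteq> v" for u v
    using before_total not_same_order assms(1) that unfolding P_def Q_def by metis
  have middle: False if "u \<in> X" "v \<in> X" "w \<in> X" "P u v" "P v w" "Q v u" "Q w v" for u v w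
  proof -
    have "(a v, v) \<in> F\<^sup>*" "(b v, v) \<in> F\<^sup>*"
      using before_rtrancl assms(1) that unfolding P_def Q_def by (meson rtrancl_trans)+
    then show False using one_arc_in_component assms(1)[OF that(2)] by (auto simp: bridge_def)
  qed
  have "x \<in> X" "y \<in> X" "z \<in> X" using assms(2) by auto
  with PQ middle assms(3-5) show False by metis
qed

lemma nonterminal_branches:
  assumes v: "v \<in> Field F" "v \<notin> Field K"
  shows "\<exists>a b. a \<noteq> b \<and> (v, a) \<in> F \<and> (v, b) \<in> F"
proof -
  \<comment> \<open>An arc into \<open>v\<close> is indispensable for a commodity that does not end
    at \<open>v\<close>, so its route has to go on.\<close>
  have "\<exists>w. (v, w) \<in> F"
  proof (cases "v \<in> Domain F")
    case False
    then obtain u where "(u, v) \<in> F" using v by (auto simp: Field_def)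
    from ex_bridge[OF this] obtain s t where br: "bridge u v s t" by blast
    have "(v, t) \<in> F\<^sup>*" using bridgeD(2)[OF br] by (rule no_exit_rtrancl_subset)
    moreover have "v \<noteq> t" using br v by (auto simp: bridge_def Field_def)
    ultimately show ?thesis by (meson converse_rtranclE)
  qed auto
  then obtain w where vw: "(v, w) \<in> F" by blast
  have "\<exists>w'. w' \<noteq> w \<and> (v, w') \<in> F"
  proof (rule ccontr)
    assume "\<not> ?thesis"
    then have uniq: "\<And>w'. (v, w') \<in> F \<Longrightarrow> w' = w" by blast
    obtain s t where br: "bridge v w s t" using ex_bridge[OF vw] by blast
    have wv: "w \<noteq> v"
    proof
      assume "w = v"
      then have "(v, t) \<in> (no_exit F v)\<^sup>*" using bridgeD(2)[OF br] by simp
      then show False using bridgeD(1,3)[OF br] by (meson rtrancl_trans)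
    qed
    \<comment> \<open>Arcs entering \<open>v\<close> are redirected to its only successor
      \<open>w\<close>, and \<open>(v, w)\<close> is dropped. Walks survive with \<open>v\<close>
      replaced by \<open>w\<close>: a step out of \<open>v\<close> becomes trivial, as both of its
      ends are sent to \<open>w\<close>. No commodity starts or ends at \<open>v\<close>, so its
      endpoints are left in place.\<close>
    define h where "h y = (if y = v then w else y)" for y
    let ?F = "(\<lambda>(x, y). (x, h y)) ` (F - {(v, w)})"
    have "(s, h t) \<in> ?F\<^sup>*" if "(s, t) \<in> F\<^sup>*" "s \<noteq> v" for s t
      using that(1)
    proof (induction rule: rtrancl_induct)
      case base
      with that show ?case by (simp add: h_def)
    next
      case (step y z)
      show ?case
      proof (cases "y = v")
        case True
        then have "h y = h z" using step.hyps(2) uniq wv by (auto simp: h_def)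
        with step.IH show ?thesis by simp
      next
        case False
        then have "(y, h z) \<in> ?F" "h y = y" using step.hyps(2) by (force, simp add: h_def)
        with step.IH show ?thesis by (metis rtrancl.rtrancl_into_rtrancl)
      qed
    qed
    note reach = this
    have "K \<subseteq> ?F\<^sup>*"
    proof (rule subrelI)
      fix s t assume st: "(s, t) \<in> K"
      then have "s \<noteq> v" "h t = t" using v by (auto simp: Field_def h_def)
      with reach[OF routes[OF st]] show "(s, t) \<in> ?F\<^sup>*" by simp
    qed
    moreover have "?F \<subseteq> R"
    proof -
      have "(x, h y) \<in> R" if "(x, y) \<in> F" for x y
        using that vw F_R trans_R by (auto simp: h_def dest: transD)
      then show ?thesis by auto
    qed
    moreover have "card (?F `` {x}) \<le> T" for x
    proof -
      have "card (?F `` {x}) \<le> card (h ` (F `` {x}))"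
        by (rule card_mono) (auto intro: finite_out)
      also have "\<dots> \<le> card (F `` {x})" by (rule card_image_le[OF finite_out])
      finally show ?thesis using degree[of x] by simp
    qed
    ultimately have "solution ?F" by (auto simp: solution_def)
    from minimal[OF this] have "card F \<le> card (F - {(v, w)})"
      using card_image_le finite_F order_trans by blast
    then show False using vw finite_F by (metis card_Diff1_less leD)
  qed
  with vw show ?thesis by blast
qed

text \<open>Each branching vertex is charged to an ordered pair of commodities for which two of its
  arcs are indispensable. With at most two vertices per pair this yields
  \<open>2 * card K ^ 2\<close>, and the terminals add \<open>2 * card K\<close>.\<close>

lemma card_support_le: "card (Field F \<union> Field K) \<le> 2 * card K * (card K + 1)"
proof -
  define X where "X = {v. \<exists>a b. a \<noteq> b \<and> (v, a) \<in> F \<and> (v, b) \<in> F}"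
  have "\<exists>a b p q. a \<noteq> b \<and> bridge v a (fst p) (snd p) \<and> bridge v b (fst q) (snd q)" if "v \<in> X" for v
    using that ex_bridge unfolding X_def by fastforce
  then obtain a b p q where abpq: "\<And>v. v \<in> X \<Longrightarrow> a v \<noteq> b v \<and>
      bridge v (a v) (fst (p v)) (snd (p v)) \<and> bridge v (b v) (fst (q v)) (snd (q v))"
    by metis
  define fib where "fib e = {v \<in> X. (p v, q v) = e}" for e
  have fib: "card (fib e) \<le> 2" for e
  proof (rule ccontr)
    assume "\<not> ?thesis"
    then have "3 \<le> card (fib e)" by simp
    then obtain Y where "Y \<subseteq> fib e" "card Y = 3" using obtain_subset_with_card_n by metis
    then obtain x y z where xyz: "x \<in> fib e" "y \<in> fib e" "z \<in> fib e" "x \<noteq> y" "y \<noteq> z" "x \<noteq> z"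
      by (auto simp: card_3_iff)
    show False
      by (rule no_three_branchings[of "fib e" a "fst (fst e)" "snd (fst e)" b "fst (snd e)" "snd (snd e)" x y z])
        (use abpq xyz in \<open>auto simp: fib_def\<close>)
  qed
  have "(p v, q v) \<in> K \<times> K" if "v \<in> X" for v using abpq[OF that] by (simp add: bridge_def)
  then have "X = (\<Union>e \<in> K \<times> K. fib e)" by (auto simp: fib_def)
  then have "card X \<le> (\<Sum>e \<in> K \<times> K. card (fib e))"
    using card_UN_le[of "K \<times> K" fib] finite_K by simp
  also have "\<dots> \<le> (\<Sum>e \<in> K \<times> K. 2)" by (rule sum_mono[OF fib])
  finally have X: "card X \<le> 2 * (card K * card K)" by (simp add: card_cartesian_product)
  have "Field K = fst ` K \<union> snd ` K" by (force simp: Field_def)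
  then have "card (Field K) \<le> card (fst ` K) + card (snd ` K)" using card_Un_le by metis
  also have "\<dots> \<le> card K + card K" by (intro add_mono card_image_le finite_K)
  finally have K: "card (Field K) \<le> 2 * card K" by simp
  have "finite X" by (rule finite_subset[OF _ finite_Domain[OF finite_F]]) (auto simp: X_def)
  have "Field F \<union> Field K \<subseteq> X \<union> Field K" using nonterminal_branches by (auto simp: X_def)
  then have "card (Field F \<union> Field K) \<le> card (X \<union> Field K)"
    by (rule card_mono[rotated]) (simp add: \<open>finite X\<close> finite_Field finite_K)
  also have "\<dots> \<le> card X + card (Field K)" by (rule card_Un_le)
  finally show ?thesis using X K by (simp add: algebra_simps)
qed

end

lemma (in routing) small_solution:
  assumes "solution F"
  obtains F' where "solution F'" "card (Field F' \<union> Field K) \<le> 2 * card K * (card K + 1)"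
proof -
  obtain F' where "solution F'" "\<And>G. solution G \<Longrightarrow> card F' \<le> card G"
    using assms ex_has_least_nat[of solution F card] by blast
  then interpret min_routing V R T K F' by unfold_locales
  show thesis using that[OF sol card_support_le] .
qed

section \<open>Colour coding\<close>

definition bit_rank :: "nat \<Rightarrow> nat \<Rightarrow> nat" where
  "bit_rank y e = (\<Sum>i<e. of_bool (bit y i))"

text \<open>The bits of \<open>x\<close> at the positions marked in \<open>y\<close>, moved together
  to the lowest positions, known as parallel bit extraction. The number of colours thus depends on
  how many bits of \<open>y\<close> are set and not on where they are.\<close>

definition colour :: "nat \<Rightarrow> nat \<Rightarrow> nat \<Rightarrow> nat" where
  "colour m y x = (\<Sum>e<m. if bit y e \<and> bit x e then 2 ^ bit_rank y e else 0)"

lemma colour_Suc: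
  "colour (Suc m) y x = colour m y x + (if bit y m \<and> bit x m then 2 ^ bit_rank y m else 0)"
  by (simp add: colour_def)

lemma bit_rank_Suc: "bit_rank y (Suc m) = bit_rank y m + of_bool (bit y m)"
  by (simp add: bit_rank_def)

lemma colour_less: "colour m y x < 2 ^ bit_rank y m"
  by (induction m) (auto simp: colour_Suc bit_rank_Suc, simp add: colour_def)

text \<open>The digit added last outweighs all earlier ones together by \<open>colour_less\<close>,
  so the selected bits can be read back from the top.\<close>

lemma colour_eqD:
  assumes "colour m y x = colour m y x'" "e < m" "bit y e"
  shows "bit x e = bit x' e"
  using assms
proof (induction m)
  case (Suc m)
  have "colour m y x = colour m y x' \<and> (bit y m \<longrightarrow> bit x m = bit x' m)"
    using Suc.prems(1) colour_less[of m y x] colour_less[of m y x']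
    by (auto simp: colour_Suc split: if_splits)
  with Suc show ?case by (cases "e = m") auto
qed simp

text \<open>\<open>Y\<close> already separates \<open>S\<close>, so at most one member of
  \<open>S\<close> agrees on it with the new element; one further position tells these two
  apart.\<close>

lemma ex_separating_bits:
  assumes "finite S" "S \<subseteq> {..<2 ^ L :: nat}"
  shows "\<exists>Y \<subseteq> {..<L}. card Y \<le> card S \<and> (\<forall>x\<in>S. \<forall>x'\<in>S. (\<forall>e\<in>Y. bit x e = bit x' e) \<longrightarrow> x = x')"
  using assms
proof (induction S rule: finite_induct)
  case (insert x S)
  then obtain Y where Y: "Y \<subseteq> {..<L}" "card Y \<le> card S"
    "\<And>u v. u \<in> S \<Longrightarrow> v \<in> S \<Longrightarrow> (\<forall>e\<in>Y. bit u e = bit v e) \<Longrightarrow> u = v" by auto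
  show ?case
  proof (cases "\<exists>z\<in>S. \<forall>e\<in>Y. bit z e = bit x e")
    case True
    then obtain z where z: "z \<in> S" "\<forall>e\<in>Y. bit z e = bit x e" by blast
    have "\<exists>e<L. bit z e \<noteq> bit x e"
    proof (rule ccontr)
      assume "\<not> ?thesis"
      then have "take_bit L z = take_bit L x" by (auto simp: bit_eq_iff bit_take_bit_iff)
      then have "z = x" using z insert.prems by (auto simp: take_bit_nat_eq_self_iff[THEN iffD2] subset_iff)
      with z insert.hyps show False by simp
    qed
    then obtain e where e: "e < L" "bit z e \<noteq> bit x e" by blast
    have "card (insert e Y) \<le> Suc (card Y)" by (rule card_insert_le_m1) simp_all
    moreover have "u = v" if "u \<in> insert x S" "v \<in> insert x S" "\<forall>i\<in>insert e Y. bit u i = bit v i" for u v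
      using that Y(3)[of u v] Y(3)[of u z] Y(3)[of v z] z e by auto
    ultimately show ?thesis using Y(1,2) e insert.hyps
      by (intro exI[of _ "insert e Y"]) auto
  next
    case False
    have "u = v" if "u \<in> insert x S" "v \<in> insert x S" "\<forall>i\<in>Y. bit u i = bit v i" for u v
      using that Y(3)[of u v] False by auto
    moreover have "card Y \<le> card (insert x S)" using Y(2) insert.hyps by simp
    ultimately show ?thesis using Y(1) by blast
  qed
qed auto

lemma ex_number_with_bits: "\<exists>y<2 ^ L :: nat. \<forall>e. bit y e \<longleftrightarrow> e < L \<and> P e"
proof (intro exI conjI allI)
  let ?y = "horner_sum of_bool 2 (map P [0..<L]) :: nat"
  show "?y < 2 ^ L" using horner_sum_of_bool_2_less[of "map P [0..<L]", where 'a = nat] by simp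
  show "bit ?y e \<longleftrightarrow> e < L \<and> P e" for e
    by (auto simp: bit_horner_sum_bit_iff)
qed

lemma ex_injective_colour:
  assumes "S \<subseteq> {..<n}" "card S \<le> q" "2 * n + 2 \<le> m"
  shows "\<exists>y<2 * n + 2. inj_on (colour m y) S \<and> (\<forall>x. colour m y x < 2 ^ q)"
proof -
  obtain L where L: "n \<le> 2 ^ L" "2 ^ L \<le> 2 * n + 2"
  proof -
    \<comment> \<open>For the least such \<open>L\<close> the power exceeds \<open>2 * n\<close>
      only if \<open>n = 0\<close>. Masks with \<open>L\<close> bits are therefore linear in number,
      and enumerating all of them is polynomial.\<close>
    define L where "L = (LEAST L. n \<le> 2 ^ L)"
    have "n \<le> 2 ^ n" using less_exp[of n] by (simp add: order_less_imp_le)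
    then have 1: "n \<le> 2 ^ L" unfolding L_def by (rule LeastI)
    have "2 ^ L \<le> 2 * n + 2"
    proof (cases L)
      case (Suc l)
      then have "\<not> n \<le> 2 ^ l" unfolding L_def by (metis not_less_Least lessI)
      with Suc show ?thesis by simp
    qed simp
    with 1 that show thesis by blast
  qed
  have "L < 2 ^ L" by (rule less_exp)
  with L assms(3) have Lm: "L \<le> m" by linarith
  have finS: "finite S" using assms(1) finite_subset by blast
  obtain Y where Y: "Y \<subseteq> {..<L}" "card Y \<le> card S"
    "\<forall>x\<in>S. \<forall>x'\<in>S. (\<forall>e\<in>Y. bit x e = bit x' e) \<longrightarrow> x = x'"
  proof -
    have "S \<subseteq> {..<2 ^ L}" using assms(1) L(1) by (auto simp: subset_iff intro: less_le_trans)
    from ex_separating_bits[OF finS this] that show thesis by blast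
  qed
  obtain y :: nat where y: "y < 2 ^ L" "\<forall>e. bit y e \<longleftrightarrow> e < L \<and> e \<in> Y"
    using ex_number_with_bits[of L "\<lambda>e. e \<in> Y"] by blast
  have "bit_rank y m = card Y"
  proof -
    have "bit_rank y m = card {i \<in> {..<m}. bit y i}"
      by (simp add: bit_rank_def Int_def)
    also have "{i \<in> {..<m}. bit y i} = Y" using y(2) Y(1) Lm by auto
    finally show ?thesis .
  qed
  then have "(2::nat) ^ bit_rank y m \<le> 2 ^ q" using Y(2) assms(2) by (intro power_increasing) auto
  then have "colour m y x < 2 ^ q" for x using colour_less[of m y x] by linarith
  moreover have "inj_on (colour m y) S"
  proof (rule inj_onI)
    fix x x' assume xx': "x \<in> S" "x' \<in> S" "colour m y x = colour m y x'"
    have "bit x e = bit x' e" if "e \<in> Y" for e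
      using colour_eqD[OF xx'(3), of e] that y(2) Y(1) Lm by auto
    with Y(3) xx' show "x = x'" by blast
  qed
  moreover have "y < 2 * n + 2" using y L by linarith
  ultimately show ?thesis by blast
qed

context routing
begin

text \<open>A colouring together with a digraph \<open>P\<close> on the colours describes the solutions in which
  every vertex has, for each arc of \<open>P\<close> leaving its colour, one successor of the head's colour.
  The vertices that can take part form the greatest set \<open>X\<close> with
  \<open>viable col P X v\<close> for all of its members \<open>v\<close>. Several of them may share
  a colour, so that no consistent choice of representatives has to be made.\<close>

definition viable :: "('a \<Rightarrow> nat) \<Rightarrow> (nat \<times> nat) set \<Rightarrow> 'a set \<Rightarrow> 'a \<Rightarrow> bool" where
  "viable col P X v \<longleftrightarrow> (\<forall>w\<in>Field K. col w = col v \<longrightarrow> w = v) \<and>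
     (\<forall>c. (col v, c) \<in> P \<longrightarrow> (\<exists>w\<in>X. col w = c \<and> (v, w) \<in> R))"

text \<open>Let every member of \<open>X\<close> fix one successor in \<open>X\<close> for each arc
  of \<open>P\<close> leaving its colour. Outdegrees are then at most those in \<open>P\<close>, and
  a walk of \<open>P\<close> lifts from any start of the right colour. The lifted walk ends at some
  vertex with the colour of \<open>t\<close>, and that vertex is \<open>t\<close>, since no member
  of \<open>X\<close> shares its colour with a different terminal.\<close>

lemma solution_from_pattern:
  assumes viable: "\<And>v. v \<in> X \<Longrightarrow> viable col P X v" and "Field K \<subseteq> X"
    and "\<And>s t. (s, t) \<in> K \<Longrightarrow> (col s, col t) \<in> P\<^sup>*"
    and deg: "\<And>v. v \<in> X \<Longrightarrow> finite (P `` {col v}) \<and> card (P `` {col v}) \<le> T"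
  shows "\<exists>F. solution F"
proof -
  define nxt where "nxt v c = (SOME w. w \<in> X \<and> col w = c \<and> (v, w) \<in> R)" for v c
  have nx: "nxt v c \<in> X \<and> col (nxt v c) = c \<and> (v, nxt v c) \<in> R" if "v \<in> X" "(col v, c) \<in> P" for v c
  proof -
    have "\<exists>w. w \<in> X \<and> col w = c \<and> (v, w) \<in> R" using viable[OF that(1)] that(2) unfolding viable_def by blast
    then show ?thesis unfolding nxt_def by (rule someI_ex)
  qed
  define F where "F = {(v, nxt v c) | v c. v \<in> X \<and> (col v, c) \<in> P}"
  have deg_F: "card (F `` {v}) \<le> T" for v
  proof (cases "v \<in> X")
    case True
    have "F `` {v} \<subseteq> nxt v ` (P `` {col v})" by (auto simp: F_def)
    then have "card (F `` {v}) \<le> card (P `` {col v})"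
      using deg[OF True] surj_card_le by blast
    with deg[OF True] show ?thesis by simp
  next
    case False
    then have "F `` {v} = {}" by (auto simp: F_def)
    then show ?thesis by simp
  qed
  have F_R: "F \<subseteq> R" using nx by (auto simp: F_def)
  have lift: "\<exists>w\<in>X. col w = c \<and> (s, w) \<in> F\<^sup>*" if "s \<in> X" "(col s, c) \<in> P\<^sup>*" for s c
    using that(2)
  proof (induction rule: rtrancl_induct)
    case (step c d)
    then obtain w where w: "w \<in> X" "col w = c" "(s, w) \<in> F\<^sup>*" by blast
    then have "(w, nxt w d) \<in> F" using step.hyps by (auto simp: F_def)
    with w(3) have "(s, nxt w d) \<in> F\<^sup>*" by (rule rtrancl_into_rtrancl)
    with nx[of w d] w(1,2) step.hyps show ?case by blast
  qed (use that in blast)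
  have "(s, t) \<in> F\<^sup>*" if "(s, t) \<in> K" for s t
  proof -
    note PK = assms(3)[OF that]
    have "s \<in> Field K" and st: "t \<in> Field K" using that by (auto simp: Field_def)
    then have sX: "s \<in> X" using assms(2) by blast
    obtain w where "w \<in> X" "col w = col t" "(s, w) \<in> F\<^sup>*"
      using lift[OF sX PK] by blast
    moreover from viable[OF this(1)] this(2) st have "t = w" unfolding viable_def by metis
    ultimately show ?thesis by simp
  qed
  then have "K \<subseteq> F\<^sup>*" by (rule subrelI)
  with F_R deg_F show ?thesis unfolding solution_def by blast
qed

text \<open>\<open>P\<close> is an isomorphic image of \<open>F\<close>. Viability is shown relative
  to every superset \<open>X\<close> of the support, because this keeps the support inside any
  greatest fixed point computed from above.\<close>

lemma pattern_from_solution: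
  assumes "solution F" and inj: "inj_on col (Field F \<union> Field K)"
  defines "P \<equiv> (\<lambda>(u, w). (col u, col w)) ` F"
  shows "Field F \<union> Field K \<subseteq> X \<Longrightarrow> v \<in> Field F \<union> Field K \<Longrightarrow> viable col P X v"
    and "(s, t) \<in> K \<Longrightarrow> (col s, col t) \<in> P\<^sup>*"
    and "card (P `` {c}) \<le> T"
proof -
  have F: "F \<subseteq> R" "\<And>v. card (F `` {v}) \<le> T" "\<And>s t. (s, t) \<in> K \<Longrightarrow> (s, t) \<in> F\<^sup>*"
    using assms(1) unfolding solution_def by blast+
  have finF: "finite F" by (rule finite_subset[OF subset_trans[OF F(1) R_subset]]) (simp add: finite_V)
  have out: "\<exists>w. (v, w) \<in> F \<and> col w = c" if v: "v \<in> Field F \<union> Field K" "(col v, c) \<in> P" for v c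
  proof -
    obtain u w where uw: "(u, w) \<in> F" "col u = col v" "col w = c" using v(2) by (auto simp: P_def)
    moreover from uw(1) have "u \<in> Field F \<union> Field K" by (auto simp: Field_def)
    ultimately have "u = v" using inj v(1) by (meson inj_onD)
    with uw show ?thesis by blast
  qed
  show "viable col P X v" if "Field F \<union> Field K \<subseteq> X" "v \<in> Field F \<union> Field K"
    unfolding viable_def
  proof (intro conjI ballI allI impI)
    fix w assume "w \<in> Field K" "col w = col v"
    then show "w = v" using inj that(2) by (meson UnI2 inj_onD)
  next
    fix c assume "(col v, c) \<in> P"
    from out[OF that(2) this] obtain w where "(v, w) \<in> F" "col w = c" by blast
    moreover from this have "w \<in> X" using that(1) by (auto simp: Field_def)
    ultimately show "\<exists>w\<in>X. col w = c \<and> (v, w) \<in> R" using F(1) by blast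
  qed
  show "(col s, col t) \<in> P\<^sup>*" if "(s, t) \<in> K"
    using F(3)[OF that]
  proof (induction rule: rtrancl_induct)
    case (step y z)
    then have "(col y, col z) \<in> P" by (force simp: P_def)
    with step.IH show ?case by simp
  qed simp
  show "card (P `` {c}) \<le> T"
  proof (cases "\<exists>v. v \<in> Field F \<and> col v = c")
    case True
    then obtain v where v: "v \<in> Field F" "col v = c" by blast
    then have "P `` {c} \<subseteq> col ` (F `` {v})" using out[of v] by blast
    then have "card (P `` {c}) \<le> card (F `` {v})"
      using finite_Image[OF finF] surj_card_le by blast
    with F(2) show ?thesis using order_trans by blast
  next
    case False
    then have "P `` {c} = {}" by (auto simp: P_def Field_def)
    then show ?thesis by simp
  qed
qed

end

section \<open>From subgraphs of the transitive closure to sets of arcs\<close>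

lemma reachable_with_proj_iff:
  assumes "parcs H \<subseteq> pverts H \<times> pverts H"
  shows "u \<rightarrow>\<^sup>*\<^bsub>with_proj H\<^esub> v \<longleftrightarrow> u \<in> pverts H \<and> (u, v) \<in> (parcs H)\<^sup>*"
proof -
  have "(u, v) \<in> (parcs H)\<^sup>* \<Longrightarrow> u \<in> pverts H \<Longrightarrow> (u, v) \<in> rtrancl_on (pverts H) (parcs H)"
    by (induction rule: rtrancl_induct) (use assms in \<open>auto intro: rtrancl_on_into_rtrancl_on\<close>)
  moreover have "arcs_ends (with_proj H) = parcs H" by (auto simp: arcs_ends_def arc_to_ends_def)
  ultimately show ?thesis
    by (auto simp: reachable_def dest: in_rtrancl_on_in_F rtrancl_on_rtranclI)
qed

lemma out_degree_with_proj: "out_degree (with_proj H) v = card (parcs H `` {v})"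
proof -
  have "out_arcs (with_proj H) v = Pair v ` (parcs H `` {v})" by (auto simp: out_arcs_def)
  then show ?thesis by (simp add: out_degree_def card_image inj_on_def)
qed

lemma max_out_degree_le_iff:
  assumes "finite (verts H)"
  shows "max_out_degree H \<le> T \<longleftrightarrow> (\<forall>v\<in>verts H. out_degree H v \<le> T)"
  using assms by (simp add: max_out_degree_def)

text \<open>The subgraph may be taken spanning, so that only its arcs matter. A negative bound is
  out of reach for outdegrees, and for the others \<open>nat T\<close> loses nothing.\<close>

lemma MD_RSPP_iff_solution:
  fixes D :: "nat pair_pre_digraph"
  assumes "pair_fin_digraph D" "K \<subseteq> pverts D \<times> pverts D"
  defines "R \<equiv> (parcs D)\<^sup>* \<inter> pverts D \<times> pverts D"
  shows "routing (pverts D) R K"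
    and "MD_RSPP (D, T, K) \<longleftrightarrow> 0 \<le> T \<and> (\<exists>F. routing.solution R (nat T) K F)"
proof -
  interpret D: pair_fin_digraph D by fact
  have wf: "parcs D \<subseteq> pverts D \<times> pverts D" using D.wellformed' by auto
  show rt: "routing (pverts D) R K"
  proof
    show "trans R" by (rule transI) (auto simp: R_def intro: rtrancl_trans)
  qed (use assms in \<open>auto simp: R_def\<close>)
  interpret routing "pverts D" R "nat T" K by (rule rt)
  have closed: "v \<in> pverts D" if "(u, v) \<in> (parcs D)\<^sup>*" "u \<in> pverts D" for u v
    using that by (induction rule: rtrancl_induct) (use wf in auto)
  have reach: "parcs (transitive_closure D) = R"
    using closed by (auto simp: transitive_closure_def R_def reachable_with_proj_iff[OF wf])
  have verts: "pverts (transitive_closure D) = pverts D" by (simp add: transitive_closure_def)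
  have wf_iff: "wf_digraph (with_proj H) \<longleftrightarrow> parcs H \<subseteq> pverts H \<times> pverts H" for H :: "nat pair_pre_digraph"
    by (auto simp: wf_digraph_def)
  show "MD_RSPP (D, T, K) \<longleftrightarrow> 0 \<le> T \<and> (\<exists>F. solution F)"
  proof
    assume "MD_RSPP (D, T, K)"
    then obtain H :: "nat pair_pre_digraph" where
      H: "subgraph (with_proj H) (with_proj (transitive_closure D))"
        "int (max_out_degree (with_proj H)) \<le> T" "\<forall>(s, t) \<in> K. s \<rightarrow>\<^sup>*\<^bsub>with_proj H\<^esub> t"
      by (auto simp: MD_RSPP_def)
    have sub: "pverts H \<subseteq> pverts D" "parcs H \<subseteq> R" "parcs H \<subseteq> pverts H \<times> pverts H"
      using H(1) by (auto simp: subgraph_def verts reach wf_iff)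
    have T: "0 \<le> T" using H(2) by linarith
    have "card (parcs H `` {v}) \<le> nat T" for v
    proof (cases "v \<in> pverts H")
      case True
      have "finite (pverts H)" using sub(1) finite_V finite_subset by blast
      then show ?thesis
        using max_out_degree_le_iff[of "with_proj H" "nat T"] H(2) T True
        by (auto simp: out_degree_with_proj)
    next
      case False
      then have "parcs H `` {v} = {}" using sub(3) by auto
      then show ?thesis by simp
    qed
    moreover have "K \<subseteq> (parcs H)\<^sup>*" using H(3) by (auto simp: reachable_with_proj_iff[OF sub(3)])
    ultimately have "solution (parcs H)" using sub(2) by (auto simp: solution_def)
    with T show "0 \<le> T \<and> (\<exists>F. solution F)" by blast
  next
    assume "0 \<le> T \<and> (\<exists>F. solution F)"
    then obtain F where T: "0 \<le> T" and "solution F" by blast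
    then have F: "F \<subseteq> R" "\<And>v. card (F `` {v}) \<le> nat T" "K \<subseteq> F\<^sup>*"
      unfolding solution_def by blast+
    define H where "H = \<lparr>pverts = pverts D, parcs = F\<rparr>"
    have FV: "parcs H \<subseteq> pverts H \<times> pverts H" using F(1) R_subset by (auto simp: H_def)
    have "subgraph (with_proj H) (with_proj (transitive_closure D))"
      using F(1) FV R_subset
      by (auto simp: subgraph_def verts reach wf_iff compatible_def) (auto simp: H_def)
    moreover have "max_out_degree (with_proj H) \<le> nat T"
      using F(2) finite_V by (subst max_out_degree_le_iff) (auto simp: out_degree_with_proj H_def)
    moreover have "\<forall>(s, t) \<in> K. s \<rightarrow>\<^sup>*\<^bsub>with_proj H\<^esub> t"
      using F(3) K_subset by (auto simp: reachable_with_proj_iff[OF FV]) (auto simp: H_def)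
    ultimately show "MD_RSPP (D, T, K)" using T by (auto simp: MD_RSPP_def)
  qed
qed

section \<open>Greatest fixpoints by iteration\<close>

definition hoare :: "nat \<Rightarrow> state \<Rightarrow> stmt \<Rightarrow> (state \<Rightarrow> bool) \<Rightarrow> bool" where
  "hoare B s p Q \<longleftrightarrow> bounded B p s \<and> Q (sem p s)"

lemma hoare_Assign:
  "ebounded B e (r, A) \<Longrightarrow> Q (r(x := eval e (r, A)), A) \<Longrightarrow> hoare B (r, A) (Assign x e) Q"
  by (simp add: hoare_def)

lemma hoare_Upd:
  "ebounded B i (r, A) \<Longrightarrow> ebounded B e (r, A) \<Longrightarrow>
    Q (r, A(a := (A a)(eval i (r, A) := eval e (r, A)))) \<Longrightarrow> hoare B (r, A) (Upd a i e) Q"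
  by (simp add: hoare_def)

lemma hoare_Then: "hoare B s p (\<lambda>s'. hoare B s' q Q) \<Longrightarrow> hoare B s (p ;; q) Q"
  by (simp add: hoare_def)

lemma hoare_For:
  assumes "r b = m" "m \<le> B" "I 0 r A"
    and "\<And>i r A. i < m \<Longrightarrow> I i r A \<Longrightarrow> hoare B (r(x := i), A) p (\<lambda>(r, A). I (Suc i) r A)"
    and "\<And>r A. I m r A \<Longrightarrow> Q (r, A)"
  shows "hoare B (r, A) (For x b p) Q"
proof -
  define h where "h i = iter (\<lambda>i t. sem p (set_reg x i t)) i (r, A)" for i
  have h: "h 0 = (r, A)" "h (Suc i) = sem p (set_reg x i (h i))" for i by (simp_all add: h_def)
  have I: "i \<le> m \<Longrightarrow> I i (fst (h i)) (snd (h i))" for i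
  proof (induction i)
    case (Suc i)
    then show ?case using assms(4)[of i "fst (h i)" "snd (h i)"]
      by (auto simp: hoare_def h(2) set_reg_def split: prod.splits)
  qed (use assms(3) h in simp)
  have "bounded B p (set_reg x i (h i))" if "i < m" for i
    using assms(4)[OF that I] that by (simp add: hoare_def set_reg_def)
  moreover have "Q (h m)" using assms(5)[OF I] by simp
  ultimately show ?thesis using assms(1,2) by (simp add: hoare_def h_def)
qed

text \<open>Every nonzero value counts as true. Disjunction is then \<open>Plus\<close>, existential
  quantification is \<open>Sum\<close>, and comparisons are truncated subtractions.\<close>

definition holds :: "exp \<Rightarrow> state \<Rightarrow> bool" where
  "holds e s \<longleftrightarrow> eval e s \<noteq> 0"

definition "Neg e = If e (Num 0) (Num 1)"
definition "Conj a b = If a b (Num 0)"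
definition "Imp a b = If a b (Num 1)"
definition "Less a b = Minus b a"
definition "Leq a b = Minus (Plus b (Num 1)) a"
definition "Equal a b = Conj (Leq a b) (Leq b a)"
definition "Forall x b e = Neg (Sum x b (Neg e))"

lemma eval_Neg [simp]: "eval (Neg e) s = of_bool (\<not> holds e s)"
  by (simp add: Neg_def holds_def)

lemma holds_simps [simp]:
  "holds (Neg e) s \<longleftrightarrow> \<not> holds e s"
  "holds (Conj a b) s \<longleftrightarrow> holds a s \<and> holds b s"
  "holds (Imp a b) s \<longleftrightarrow> (holds a s \<longrightarrow> holds b s)"
  "holds (Plus a b) s \<longleftrightarrow> holds a s \<or> holds b s"
  "holds (Less a b) s \<longleftrightarrow> eval a s < eval b s"
  "holds (Leq a b) s \<longleftrightarrow> eval a s \<le> eval b s"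
  "holds (Equal a b) s \<longleftrightarrow> eval a s = eval b s"
  "holds (Forall x y e) s \<longleftrightarrow> (\<forall>i<fst s y. holds e (set_reg x i s))"
  "holds (Sum x y e) s \<longleftrightarrow> (\<exists>i<fst s y. holds e (set_reg x i s))"
  "holds (Arr c e) s \<longleftrightarrow> snd s c (eval e s) \<noteq> 0"
  "holds (Num 0) s \<longleftrightarrow> False"
  "holds (If g a b) s \<longleftrightarrow> (if holds g s then holds a s else holds b s)"
  by (auto simp: Conj_def Imp_def Less_def Leq_def Equal_def Forall_def holds_def)

lemma eval_If_holds: "eval (If g a b) s = (if holds g s then eval a s else eval b s)"
  by (simp add: holds_def)

lemma ebounded_simps [simp]:
  "ebounded B (Neg e) s \<longleftrightarrow> ebounded B e s"
  "ebounded B (Conj a b) s \<longleftrightarrow> ebounded B a s \<and> ebounded B b s"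
  "ebounded B (Imp a b) s \<longleftrightarrow> ebounded B a s \<and> ebounded B b s"
  "ebounded B (Less a b) s \<longleftrightarrow> ebounded B a s \<and> ebounded B b s"
  "ebounded B (Leq a b) s \<longleftrightarrow> ebounded B a s \<and> ebounded B b s"
  "ebounded B (Equal a b) s \<longleftrightarrow> ebounded B a s \<and> ebounded B b s"
  "ebounded B (Forall x y e) s \<longleftrightarrow> fst s y \<le> B \<and> (\<forall>i<fst s y. ebounded B e (set_reg x i s))"
  by (auto simp: Conj_def Imp_def Less_def Leq_def Equal_def Forall_def Neg_def)

lemma evars_simps [simp]:
  "evars (Neg e) = evars e" "evars (Conj a b) = evars a \<union> evars b"
  "evars (Imp a b) = evars a \<union> evars b" "evars (Less a b) = evars a \<union> evars b"
  "evars (Leq a b) = evars a \<union> evars b" "evars (Equal a b) = evars a \<union> evars b"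
  "evars (Forall x y e) = {x, y} \<union> evars e"
  by (auto simp: Conj_def Imp_def Less_def Leq_def Equal_def Forall_def Neg_def)

text \<open>Violators are removed in place, without testing for stability: every sweep over an
  unstable set removes something, so as many sweeps as there are vertices suffice.\<close>

definition gfp_loop :: "nat \<Rightarrow> nat \<Rightarrow> nat \<Rightarrow> nat \<Rightarrow> exp \<Rightarrow> stmt" where
  "gfp_loop a x z b e =
     For x b (Upd a (Var x) (Num 1)) ;;
     For z b (For x b (Upd a (Var x) (Conj (Arr a (Var x)) e)))"

definition support :: "nat \<Rightarrow> (nat \<Rightarrow> nat) \<Rightarrow> nat set" where
  "support n f = {v. v < n \<and> f v \<noteq> 0}"

text \<open>Monotonicity of \<open>\<Phi>\<close> is asked for only at the sets \<open>S\<close>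
  being compared: if the members of \<open>S\<close> satisfy \<open>\<Phi> X\<close> for every
  \<open>X\<close> above \<open>S\<close>, then none of them is ever removed, in whichever order the
  others disappear.\<close>

lemma hoare_gfp_loop:
  assumes regs: "x \<noteq> z" "x \<noteq> b" "z \<noteq> b" and n: "r\<^sub>0 b = n" "n \<le> B"
    and e: "\<And>r A. (\<And>y. y \<noteq> x \<Longrightarrow> y \<noteq> z \<Longrightarrow> r y = r\<^sub>0 y) \<Longrightarrow> (\<And>c. c \<noteq> a \<Longrightarrow> A c = A\<^sub>0 c) \<Longrightarrow> r x < n \<Longrightarrow>
      ebounded B e (r, A) \<and> (holds e (r, A) \<longleftrightarrow> \<Phi> (support n (A a)) (r x))"
    and Q: "\<And>r A. (\<And>y. y \<noteq> x \<Longrightarrow> y \<noteq> z \<Longrightarrow> r y = r\<^sub>0 y) \<Longrightarrow> (\<And>c. c \<noteq> a \<Longrightarrow> A c = A\<^sub>0 c) \<Longrightarrow>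
      (\<And>v. v \<in> support n (A a) \<Longrightarrow> \<Phi> (support n (A a)) v) \<Longrightarrow>
      (\<And>S. S \<subseteq> {..<n} \<Longrightarrow> (\<And>X v. S \<subseteq> X \<Longrightarrow> X \<subseteq> {..<n} \<Longrightarrow> v \<in> S \<Longrightarrow> \<Phi> X v) \<Longrightarrow> S \<subseteq> support n (A a)) \<Longrightarrow>
      Q (r, A)"
  shows "hoare B (r\<^sub>0, A\<^sub>0) (gfp_loop a x z b e) Q"
proof -
  define frame where "frame r A \<longleftrightarrow> (\<forall>y. y \<noteq> x \<longrightarrow> y \<noteq> z \<longrightarrow> r y = r\<^sub>0 y) \<and> (\<forall>c. c \<noteq> a \<longrightarrow> A c = A\<^sub>0 c)"
    for r :: "nat \<Rightarrow> nat" and A :: "nat \<Rightarrow> nat \<Rightarrow> nat"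
  define post where "post X \<longleftrightarrow> (\<forall>S. S \<subseteq> {..<n} \<longrightarrow>
      (\<forall>X v. S \<subseteq> X \<longrightarrow> X \<subseteq> {..<n} \<longrightarrow> v \<in> S \<longrightarrow> \<Phi> X v) \<longrightarrow> S \<subseteq> X)" for X
  define stable where "stable X \<longleftrightarrow> (\<forall>v\<in>X. \<Phi> X v)" for X
  have sub: "support n f \<subseteq> {..<n}" and fin: "finite (support n f)" for f
    by (auto simp: support_def)
  have post_remove: "post (X - {v})" if "post X" "X \<subseteq> {..<n}" "\<not> \<Phi> X v" for X v
    using that unfolding post_def by blast
  show ?thesis
    unfolding gfp_loop_def
  proof (rule hoare_Then, rule hoare_For[where m = n and I = "\<lambda>i r A. frame r A \<and> (\<forall>v<i. A a v \<noteq> 0)"])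
    fix r A assume A: "frame r A \<and> (\<forall>v<n. A a v \<noteq> 0)"
    then have full: "support n (A a) = {..<n}" by (auto simp: support_def)
    show "hoare B (r, A) (For z b (For x b (Upd a (Var x) (Conj (Arr a (Var x)) e)))) Q"
    \<comment> \<open>After \<open>j\<close> sweeps the set is stable or has lost at least
      \<open>j\<close> vertices.\<close>
    proof (rule hoare_For[where m = n and I = "\<lambda>j r A. frame r A \<and> post (support n (A a)) \<and>
        (stable (support n (A a)) \<or> card (support n (A a)) + j \<le> n)"])
      show "r b = n" using A regs n by (auto simp: frame_def)
      show "frame r A \<and> post (support n (A a)) \<and> (stable (support n (A a)) \<or> card (support n (A a)) + 0 \<le> n)"
        using A full by (simp add: post_def)
    next
      fix j r A
      assume j: "j < n" and I: "frame r A \<and> post (support n (A a)) \<and>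
        (stable (support n (A a)) \<or> card (support n (A a)) + j \<le> n)"
      define X0 where "X0 = support n (A a)"
      have X0: "finite X0" using fin by (simp add: X0_def)
      \<comment> \<open>As long as nothing has been removed during the sweep, all vertices passed
        were tested against \<open>X0\<close> itself, so a sweep without removals proves
        \<open>X0\<close> stable. Conversely the first removal shows that \<open>X0\<close> was not
        stable.\<close>
      let ?J = "\<lambda>i r A. frame r A \<and> post (support n (A a)) \<and> support n (A a) \<subseteq> X0 \<and>
          (stable X0 \<longrightarrow> support n (A a) = X0) \<and>
          (support n (A a) = X0 \<longrightarrow> (\<forall>v<i. v \<in> X0 \<longrightarrow> \<Phi> X0 v))"
      show "hoare B (r(z := j), A) (For x b (Upd a (Var x) (Conj (Arr a (Var x)) e)))
        (\<lambda>(r, A). frame r A \<and> post (support n (A a)) \<and>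
          (stable (support n (A a)) \<or> card (support n (A a)) + Suc j \<le> n))"
      proof (rule hoare_For[where m = n and I = ?J])
        show "(r(z := j)) b = n" using I regs n by (auto simp: frame_def)
        show "?J 0 (r(z := j)) A" using I by (auto simp: frame_def X0_def)
      next
        fix i r A assume i: "i < n" and J: "?J i r A"
        let ?r = "r(x := i)"
        have ei: "ebounded B e (?r, A) \<and> (holds e (?r, A) \<longleftrightarrow> \<Phi> (support n (A a)) i)"
          using e[of ?r A] J i by (auto simp: frame_def)
        let ?A = "A(a := (A a)(i := eval (Conj (Arr a (Var x)) e) (?r, A)))"
        have new: "support n (?A a) = (if \<Phi> (support n (A a)) i then support n (A a) else support n (A a) - {i})"
          using i ei holds_simps(2)[of "Arr a (Var x)" e "(?r, A)"]
          unfolding support_def by (auto simp: holds_def)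
        have "?J (Suc i) ?r ?A"
        proof (cases "\<Phi> (support n (A a)) i \<or> i \<notin> support n (A a)")
          case True
          then have "support n (?A a) = support n (A a)" using new by auto
          with J True show ?thesis by (auto simp: frame_def less_Suc_eq)
        next
          case False
          then have 1: "support n (?A a) = support n (A a) - {i}" "i \<in> support n (A a)" using new by auto
          have "post (support n (?A a))" unfolding 1(1) using J False sub by (intro post_remove) auto
          moreover have "\<not> stable X0" using J False unfolding stable_def by metis
          moreover have "support n (?A a) \<noteq> X0" "support n (?A a) \<subseteq> X0" using J 1 by auto
          ultimately show ?thesis using J by (auto simp: frame_def)
        qed
        then show "hoare B (?r, A) (Upd a (Var x) (Conj (Arr a (Var x)) e)) (\<lambda>(r, A). ?J (Suc i) r A)"
          using ei by (intro hoare_Upd) simp_all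
      next
        fix r A assume J: "?J n r A"
        have "stable (support n (A a)) \<or> card (support n (A a)) + Suc j \<le> n"
        proof (cases "support n (A a) = X0")
          case True
          moreover have "X0 \<subseteq> {..<n}" using sub by (simp add: X0_def)
          ultimately show ?thesis using J by (auto simp: stable_def)
        next
          case False
          then have "card (support n (A a)) < card X0" "\<not> stable X0" using J X0 by (auto intro: psubset_card_mono)
          then show ?thesis using I by (auto simp: X0_def[symmetric])
        qed
        with J show "case (r, A) of (r, A) \<Rightarrow> frame r A \<and> post (support n (A a)) \<and>
          (stable (support n (A a)) \<or> card (support n (A a)) + Suc j \<le> n)" by simp
      qed (rule n)
    next
      fix r A assume I: "frame r A \<and> post (support n (A a)) \<and>
        (stable (support n (A a)) \<or> card (support n (A a)) + n \<le> n)"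
      \<comment> \<open>In the second case the set is empty, and thus stable.\<close>
      then have "stable (support n (A a))" using fin by (auto simp: stable_def)
      with I show "Q (r, A)" by (intro Q) (auto simp: frame_def stable_def post_def)
    qed (rule n)
  qed (use n in \<open>auto simp: frame_def less_Suc_eq intro!: hoare_Upd\<close>)
qed

section \<open>The program\<close>

text \<open>Registers from 20 on are loop variables of expressions. The macros \<open>times_reg\<close> and
  \<open>bit_exp\<close> below bind the registers 26 and 30, 31, which therefore must not occur in
  their arguments.\<close>

abbreviation (input) "rn \<equiv> 2 :: nat"
abbreviation (input) "rT \<equiv> 3 :: nat"
abbreviation (input) "rneg \<equiv> 4 :: nat"
abbreviation (input) "rk \<equiv> 5 :: nat"
abbreviation (input) "rq \<equiv> 6 :: nat"
abbreviation (input) "rC \<equiv> 7 :: nat"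
abbreviation (input) "rC2 \<equiv> 8 :: nat"
abbreviation (input) "rR \<equiv> 9 :: nat"
abbreviation (input) "rn2 \<equiv> 10 :: nat"
abbreviation (input) "rM \<equiv> 11 :: nat"
abbreviation (input) "rans \<equiv> 12 :: nat"
abbreviation (input) "ry \<equiv> 13 :: nat"
abbreviation (input) "rN \<equiv> 14 :: nat"
abbreviation (input) "rt \<equiv> 15 :: nat"
abbreviation (input) "rx \<equiv> 16 :: nat"
abbreviation (input) "rz \<equiv> 17 :: nat"
abbreviation (input) "ri \<equiv> 18 :: nat"

abbreviation (input) "aPow \<equiv> 2 :: nat"
abbreviation (input) "aReach \<equiv> 3 :: nat"
abbreviation (input) "aUnr \<equiv> 4 :: nat"
abbreviation (input) "aCol \<equiv> 5 :: nat"
abbreviation (input) "aX \<equiv> 6 :: nat"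

abbreviation "times_reg b e \<equiv> Sum 26 b e"

text \<open>The offset 3 skips the number of vertices, the sign and the absolute value of the bound;
  the commodity matrix starts \<open>n * n\<close> entries further on.\<close>

definition "arc_exp i j = Arr 0 (Plus (Num 3) (Plus (times_reg rn (Var i)) (Var j)))"
definition "demand_exp i j =
  Arr 0 (Plus (Num 3) (Plus (times_reg rn (Var rn)) (Plus (times_reg rn (Var i)) (Var j))))"

definition "pow_stmt x b =
  Assign x (Num 1) ;; For ri b (Assign x (Plus (Var x) (Var x)))"

text \<open>A block of its own, because the proof that the time bound is computable runs the same
  code.\<close>

definition "params =
  Assign rq (Sum 20 rk (Plus (Plus (Var rk) (Var rk)) (Num 2))) ;;
  pow_stmt rC rq ;;
  Assign rC2 (times_reg rC (Var rC)) ;;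
  pow_stmt rR rC2"

definition "pow_table =
  Upd aPow (Num 0) (Num 1) ;;
  For ri rM (Upd aPow (Plus (Var ri) (Num 1)) (Plus (Arr aPow (Var ri)) (Arr aPow (Var ri))))"

definition "setup =
  Assign rn (Arr 0 (Num 0)) ;;
  Assign rneg (Arr 0 (Num 1)) ;;
  Assign rT (Arr 0 (Num 2)) ;;
  Assign rk (Sum 20 rn (Sum 21 rn (demand_exp 20 21))) ;;
  params ;;
  Assign rn2 (Plus (Plus (Var rn) (Var rn)) (Num 2)) ;;
  Assign rM (Plus (Var rR) (Var rn2)) ;;
  pow_table"

text \<open>The vertices that cannot reach \<open>t\<close> are the greatest set that misses
  \<open>t\<close> and is closed under arcs, so the loop for greatest fixed points also yields the
  transitive closure, one target at a time.\<close>

definition "reach_stmt =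
  For rt rn
    (gfp_loop aUnr rx rz rn
       (Conj (Neg (Equal (Var rx) (Var rt))) (Forall 20 rn (Imp (arc_exp rx 20) (Arr aUnr (Var 20))))) ;;
     For ri rn (Upd aReach (Plus (times_reg rn (Var ri)) (Var rt)) (Neg (Arr aUnr (Var ri)))))"

text \<open>A search for the quotient in \<open>bit_iff_quotient\<close>, with
  \<open>Sum 31 30\<close> multiplying by the candidate in register 30. The value is merely zero or
  nonzero, hence the \<open>If\<close> around it wherever bits are counted.\<close>

definition "bit_exp a e =
  (let d = Plus (Sum 31 30 (Arr aPow (Plus e (Num 1)))) (Arr aPow e)
   in Sum 30 rM (Conj (Leq d (Var a)) (Less (Var a) (Plus d (Arr aPow e)))))"

definition "colour_exp =
  Sum 24 rM (If (Conj (bit_exp ry (Var 24)) (bit_exp ri (Var 24)))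
    (Arr aPow (Sum 25 24 (If (bit_exp ry (Var 25)) (Num 1) (Num 0)))) (Num 0))"

definition "terminal_exp w = Sum 22 rn (Plus (demand_exp w 22) (demand_exp 22 w))"

definition "viable_exp = Conj
  (Forall 20 rn (Imp (Conj (terminal_exp 20) (Equal (Arr aCol (Var 20)) (Arr aCol (Var rx))))
     (Equal (Var 20) (Var rx))))
  (Forall 20 rC (Imp (bit_exp rN (Plus (times_reg rC (Arr aCol (Var rx))) (Var 20)))
     (Sum 21 rn (Conj (Arr aX (Var 21)) (Conj (Equal (Arr aCol (Var 21)) (Var 20))
        (Arr aReach (Plus (times_reg rn (Var rx)) (Var 21))))))))"

text \<open>A vertex is reachable iff it lies in every closed set containing the start; the closed
  sets of colours are enumerated as bit masks.\<close>

definition "pattern_reach_exp s t =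
  Forall 33 rR (Imp
    (Conj (bit_exp 33 (Arr aCol (Var s)))
      (Forall 34 rC (Forall 35 rC (Imp
        (Conj (bit_exp 33 (Var 34)) (bit_exp rN (Plus (times_reg rC (Var 34)) (Var 35))))
        (bit_exp 33 (Var 35))))))
    (bit_exp 33 (Arr aCol (Var t))))"

definition "accept_exp = Conj
  (Forall 20 rC (Leq (Sum 21 rC (If (bit_exp rN (Plus (times_reg rC (Var 20)) (Var 21))) (Num 1) (Num 0)))
     (Var rT)))
  (Forall 20 rn (Forall 21 rn (Imp (demand_exp 20 21)
     (Conj (Arr aX (Var 20)) (Conj (Arr aX (Var 21)) (pattern_reach_exp 20 21))))))"

definition "try_stmt =
  For ri rn (Upd aCol (Var ri) (If (Less colour_exp (Var rC)) colour_exp (Num 0))) ;;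
  gfp_loop aX rx rz rn viable_exp ;;
  Assign rans (If accept_exp (Num 1) (Var rans))"

text \<open>The search uses the absolute value of the bound; the sign overrides its answer at the
  end.\<close>

definition "decide =
  setup ;;
  reach_stmt ;;
  Assign rans (Num 0) ;;
  For ry rn2 (For rN rR try_stmt) ;;
  Assign 0 (If (Var rneg) (Num 0) (Var rans))"

section \<open>Bit tests, powers of two and parameters\<close>

lemma holds_Var [simp]: "holds (Var x) s \<longleftrightarrow> fst s x \<noteq> 0"
  and holds_Num1 [simp]: "holds (Num 1) s" "holds (Num (Suc 0)) s"
  by (simp_all add: holds_def)

text \<open>The bit is set iff \<open>x div 2 ^ e\<close> is odd, say \<open>2 * i + 1\<close>. As
  \<open>i \<le> x\<close>, a search below any \<open>m > x\<close> finds it.\<close>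

lemma bit_iff_quotient:
  fixes x :: nat
  assumes "x < m"
  shows "bit x e \<longleftrightarrow> (\<exists>i<m. i * 2 ^ (e + 1) + 2 ^ e \<le> x \<and> x < i * 2 ^ (e + 1) + 2 ^ e + 2 ^ e)"
proof
  assume "bit x e"
  then have "odd (x div 2 ^ e)" by (simp add: bit_iff_odd)
  then obtain i where "x div 2 ^ e = 2 * i + 1" by (rule oddE)
  then have "2 ^ e * (2 * i + 1) \<le> x" "x < 2 ^ e * (2 * i + 1) + 2 ^ e"
    using times_div_less_eq_dividend[of "2 ^ e" x] dividend_less_times_div[of "2 ^ e" x] by auto
  moreover have "i < m"
  proof -
    have "1 * i \<le> 2 ^ e * (2 * i + 1)" by (rule mult_le_mono) auto
    with calculation assms show ?thesis by linarith
  qed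
  ultimately show "\<exists>i<m. i * 2 ^ (e + 1) + 2 ^ e \<le> x \<and> x < i * 2 ^ (e + 1) + 2 ^ e + 2 ^ e"
    by (intro exI[of _ i]) (simp add: algebra_simps)
next
  assume "\<exists>i<m. i * 2 ^ (e + 1) + 2 ^ e \<le> x \<and> x < i * 2 ^ (e + 1) + 2 ^ e + 2 ^ e"
  then obtain i where "2 ^ e * (2 * i + 1) \<le> x" "x < 2 ^ e * (2 * i + 2)"
    by (auto simp: algebra_simps)
  then have "x div 2 ^ e = 2 * i + 1"
    by (intro div_nat_eqI) (simp_all add: algebra_simps)
  then show "bit x e" by (simp add: bit_iff_odd)
qed

lemma eval_upd_fresh:
  "x \<notin> evars e \<Longrightarrow> eval e (r(x := i), A) = eval e (r, A)"
  "x \<notin> evars e \<Longrightarrow> ebounded B e (r(x := i), A) = ebounded B e (r, A)"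
  by (auto intro!: eval_cong ebounded_cong)

lemma bit_exp_correct:
  assumes "\<forall>e\<le>m. A aPow e = 2 ^ e" "r rM = m" "30 \<notin> evars e" "31 \<notin> evars e" "a \<noteq> 30" "a \<noteq> 31"
    "r a < m" "eval e (r, A) < m"
  shows "holds (bit_exp a e) (r, A) \<longleftrightarrow> bit (r a) (eval e (r, A))"
  using assms by (simp add: bit_exp_def Let_def eval_upd_fresh bit_iff_quotient[of "r a" m])

lemma ebounded_bit_exp:
  assumes "r rM \<le> B" "30 \<notin> evars e" "31 \<notin> evars e" "ebounded B e (r, A)"
  shows "ebounded B (bit_exp a e) (r, A)"
  using assms by (simp add: bit_exp_def Let_def eval_upd_fresh)

lemma evars_bit_exp [simp]: "evars (bit_exp a e) = {30, 31, rM, a} \<union> evars e"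
  by (auto simp: bit_exp_def Let_def)

lemma hoare_pow_stmt:
  assumes "x \<noteq> b" "x \<noteq> ri" "b \<noteq> ri" "r b \<le> B"
    and Q: "\<And>r'. r' x = 2 ^ r b \<Longrightarrow> (\<And>y. y \<noteq> x \<Longrightarrow> y \<noteq> ri \<Longrightarrow> r' y = r y) \<Longrightarrow> Q (r', A)"
  shows "hoare B (r, A) (pow_stmt x b) Q"
  unfolding pow_stmt_def
proof (rule hoare_Then, rule hoare_Assign)
  show "hoare B (r(x := eval (Num 1) (r, A)), A) (For ri b (Assign x (Plus (Var x) (Var x)))) Q"
    by (rule hoare_For[where m = "r b" and
          I = "\<lambda>i r' A'. A' = A \<and> r' x = 2 ^ i \<and> (\<forall>y. y \<noteq> x \<longrightarrow> y \<noteq> ri \<longrightarrow> r' y = r y)"])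
      (use assms in \<open>auto intro!: hoare_Assign\<close>)
qed simp

text \<open>The bound on the support of a smallest solution, the number of colours obtained from
  that many bits, and the number of digraphs on these colours.\<close>

definition q_of :: "nat \<Rightarrow> nat" where "q_of k = 2 * k * (k + 1)"
definition C_of :: "nat \<Rightarrow> nat" where "C_of k = 2 ^ q_of k"
definition R_of :: "nat \<Rightarrow> nat" where "R_of k = 2 ^ (C_of k * C_of k)"

lemma params_order: "k \<le> R_of k" "q_of k \<le> R_of k" "C_of k \<le> R_of k"
    "C_of k * C_of k < R_of k" "0 < C_of k"
proof -
  have 1: "k \<le> q_of k" "q_of k < C_of k" "C_of k \<le> C_of k * C_of k" "C_of k * C_of k < R_of k"
    by (auto simp: q_of_def C_of_def R_of_def less_exp)
  show "C_of k * C_of k < R_of k" by (rule 1)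
  show "0 < C_of k" by (simp add: C_of_def)
  show "C_of k \<le> R_of k" using 1(3,4) by linarith
  then show "q_of k \<le> R_of k" using 1(2) by linarith
  then show "k \<le> R_of k" using 1(1) by linarith
qed

lemma hoare_params:
  assumes k: "r rk = k" "R_of k \<le> B"
    and Q: "\<And>r'. r' rq = q_of k \<Longrightarrow> r' rC = C_of k \<Longrightarrow> r' rC2 = C_of k * C_of k \<Longrightarrow> r' rR = R_of k \<Longrightarrow>
      (\<And>y. y \<notin> {rq, rC, rC2, rR, ri} \<Longrightarrow> r' y = r y) \<Longrightarrow> Q (r', A)"
  shows "hoare B (r, A) params Q"
  unfolding params_def
proof (rule hoare_Then, rule hoare_Assign)
  let ?r1 = "r(rq := eval (Sum 20 rk (Plus (Plus (Var rk) (Var rk)) (Num 2))) (r, A))"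
  have r1: "?r1 rq = q_of k" using k by (simp add: q_of_def algebra_simps)
  show "ebounded B (Sum 20 rk (Plus (Plus (Var rk) (Var rk)) (Num 2))) (r, A)"
    using k params_order[of k] by simp
  show "hoare B (?r1, A) (pow_stmt rC rq ;; Assign rC2 (times_reg rC (Var rC)) ;; pow_stmt rR rC2) Q"
  proof (rule hoare_Then, rule hoare_pow_stmt)
    fix r2 assume r2: "r2 rC = 2 ^ ?r1 rq" "\<And>y. y \<noteq> rC \<Longrightarrow> y \<noteq> ri \<Longrightarrow> r2 y = ?r1 y"
    have C: "r2 rC = C_of k" using r2(1) unfolding r1 by (simp add: C_of_def)
    show "hoare B (r2, A) (Assign rC2 (times_reg rC (Var rC)) ;; pow_stmt rR rC2) Q"
    proof (rule hoare_Then, rule hoare_Assign)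
      let ?r3 = "r2(rC2 := eval (times_reg rC (Var rC)) (r2, A))"
      have C2: "?r3 rC2 = C_of k * C_of k" using C by simp
      show "ebounded B (times_reg rC (Var rC)) (r2, A)" using C k params_order[of k] by simp
      show "hoare B (?r3, A) (pow_stmt rR rC2) Q"
      proof (rule hoare_pow_stmt)
        fix r4 assume r4: "r4 rR = 2 ^ ?r3 rC2" "\<And>y. y \<noteq> rR \<Longrightarrow> y \<noteq> ri \<Longrightarrow> r4 y = ?r3 y"
        show "Q (r4, A)"
        proof (rule Q)
          show "r4 rq = q_of k" using r4(2)[of rq] r2(2)[of rq] r1 by simp
          show "r4 rC = C_of k" using r4(2)[of rC] C by simp
          show "r4 rC2 = C_of k * C_of k" using r4(2)[of rC2] C2 by simp
          show "r4 rR = R_of k" using r4(1) unfolding C2 by (simp add: R_of_def)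
          show "r4 y = r y" if "y \<notin> {rq, rC, rC2, rR, ri}" for y
            using that r4(2)[of y] r2(2)[of y] by simp
        qed
      qed (use C2 k params_order[of k] in simp_all)
    qed
  qed (use r1 k params_order[of k] in simp_all)
qed


section \<open>Correctness of the program: input, tables and reachability\<close>

locale encoded_instance =
  fixes n T neg :: nat and E K :: "(nat \<times> nat) set" and inp :: "nat \<Rightarrow> nat"
  assumes E_subset: "E \<subseteq> {..<n} \<times> {..<n}" and K_subset_n: "K \<subseteq> {..<n} \<times> {..<n}"
    and inp_params: "inp 0 = n" "inp 1 = neg" "inp 2 = T"
    and inp_E: "\<And>i j. i < n \<Longrightarrow> j < n \<Longrightarrow> inp (3 + (n * i + j)) = of_bool ((i, j) \<in> E)"
    and inp_K: "\<And>i j. i < n \<Longrightarrow> j < n \<Longrightarrow> inp (3 + (n * n + (n * i + j))) = of_bool ((i, j) \<in> K)"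
begin

definition "k = card K"
definition "C = C_of k"
definition "R = R_of k"
definition "n2 = 2 * n + 2"
text \<open>A common bound for all loops. It also exceeds the masks \<open>y\<close> and
  \<open>N\<close>, the vertices and the bit positions below \<open>C * C\<close>, as required for
  bit tests and for looking up powers of two.\<close>

definition "M = R + n2"

lemma order: "n \<le> M" "k \<le> M" "q_of k \<le> M" "C \<le> M" "C * C < M" "R \<le> M" "n2 \<le> M" "0 < C" "C \<le> R"
    "C * C < R" "n < n2"
  using params_order[of k] by (simp_all add: C_def R_def n2_def M_def)

definition env :: "(nat \<Rightarrow> nat) \<Rightarrow> (nat \<Rightarrow> nat \<Rightarrow> nat) \<Rightarrow> bool" where
  "env r A \<longleftrightarrow> r rn = n \<and> r rT = T \<and> r rneg = neg \<and> r rC = C \<and> r rR = R \<and> r rn2 = n2 \<and> r rM = M \<and>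
     A 0 = inp \<and> (\<forall>e\<le>M. A aPow e = 2 ^ e)"

lemma eval_demand_exp:
  assumes "r rn = n" "A 0 = inp" "r i < n" "r j < n" "i \<noteq> 26" "j \<noteq> 26"
  shows "eval (demand_exp i j) (r, A) = of_bool ((r i, r j) \<in> K)"
  using assms inp_K by (simp add: demand_exp_def)

lemma holds_demand_exp:
  assumes "r rn = n" "A 0 = inp" "r i < n" "r j < n" "i \<noteq> 26" "j \<noteq> 26"
  shows "holds (demand_exp i j) (r, A) \<longleftrightarrow> (r i, r j) \<in> K"
  using eval_demand_exp[of r A i j] assms by (simp add: holds_def)

lemma holds_arc_exp:
  assumes "r rn = n" "A 0 = inp" "r i < n" "r j < n" "i \<noteq> 26" "j \<noteq> 26"
  shows "holds (arc_exp i j) (r, A) \<longleftrightarrow> (r i, r j) \<in> E"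
  using assms inp_E by (simp add: arc_exp_def)

lemma ebounded_arc_demand:
  assumes "r rn \<le> B"
  shows "ebounded B (demand_exp i j) (r, A)" "ebounded B (arc_exp i j) (r, A)"
  using assms by (simp_all add: demand_exp_def arc_exp_def)

lemma card_K: "(\<Sum>i<n. \<Sum>j<n. of_bool ((i, j) \<in> K)) = k"
proof -
  have "(\<Sum>i<n. \<Sum>j<n. of_bool ((i, j) \<in> K) :: nat) = (\<Sum>e\<in>{..<n} \<times> {..<n}. of_bool (e \<in> K))"
    by (simp only: sum.cartesian_product split_def prod.collapse)
  also have "\<dots> = card (({..<n} \<times> {..<n}) \<inter> K)" by (simp add: Int_def)
  also have "({..<n} \<times> {..<n}) \<inter> K = K" using K_subset_n by blast
  finally show ?thesis by (simp add: k_def)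
qed

lemma hoare_pow_table:
  assumes "r rM \<le> B"
    and Q: "\<And>r' A'. (\<And>y. y \<noteq> ri \<Longrightarrow> r' y = r y) \<Longrightarrow> (\<And>c. c \<noteq> aPow \<Longrightarrow> A' c = A c) \<Longrightarrow>
      (\<forall>e\<le>r rM. A' aPow e = 2 ^ e) \<Longrightarrow> Q (r', A')"
  shows "hoare B (r, A) pow_table Q"
  unfolding pow_table_def
proof (rule hoare_Then, rule hoare_Upd)
  let ?A = "A(aPow := (A aPow)(eval (Num 0) (r, A) := eval (Num 1) (r, A)))"
  show "hoare B (r, ?A)
     (For ri rM (Upd aPow (Plus (Var ri) (Num 1)) (Plus (Arr aPow (Var ri)) (Arr aPow (Var ri))))) Q"
    by (rule hoare_For[where m = "r rM" and I = "\<lambda>i r' A'. (\<forall>y. y \<noteq> ri \<longrightarrow> r' y = r y) \<and>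
          (\<forall>c. c \<noteq> aPow \<longrightarrow> A' c = A c) \<and> (\<forall>e\<le>i. A' aPow e = 2 ^ e)"])
      (use assms in \<open>auto intro!: hoare_Upd simp: le_Suc_eq\<close>)
qed simp_all

lemma hoare_setup:
  assumes "A 0 = inp" and Q: "\<And>r' A'. env r' A' \<Longrightarrow> Q (r', A')"
  shows "hoare M (r, A) setup Q"
  unfolding setup_def
proof (intro hoare_Then hoare_Assign)
  let ?r1 = "r(rn := eval (Arr 0 (Num 0)) (r, A))"
  let ?r2 = "?r1(rneg := eval (Arr 0 (Num 1)) (?r1, A))"
  let ?r3 = "?r2(rT := eval (Arr 0 (Num 2)) (?r2, A))"
  let ?r4 = "?r3(rk := eval (Sum 20 rn (Sum 21 rn (demand_exp 20 21))) (?r3, A))"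
  have r3: "?r3 rn = n" "?r3 rneg = neg" "?r3 rT = T" using assms inp_params by simp_all
  have k: "?r4 rk = k" using r3 assms card_K by (simp add: eval_demand_exp)
  show "ebounded M (Sum 20 rn (Sum 21 rn (demand_exp 20 21))) (?r3, A)"
    using r3 order by (simp add: ebounded_arc_demand)
  show "hoare M (?r4, A) params (\<lambda>s'. hoare M s'
    (Assign rn2 (Plus (Plus (Var rn) (Var rn)) (Num 2)) ;; Assign rM (Plus (Var rR) (Var rn2)) ;; pow_table) Q)"
  proof (rule hoare_params[where k = k], rule k)
    show "R_of k \<le> M" using order by (simp add: R_def)
  next
    fix r5 assume r5: "r5 rq = q_of k" "r5 rC = C_of k" "r5 rC2 = C_of k * C_of k" "r5 rR = R_of k"
      "\<And>y. y \<notin> {rq, rC, rC2, rR, ri} \<Longrightarrow> r5 y = ?r4 y"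
    let ?r6 = "r5(rn2 := eval (Plus (Plus (Var rn) (Var rn)) (Num 2)) (r5, A))"
    let ?r7 = "?r6(rM := eval (Plus (Var rR) (Var rn2)) (?r6, A))"
    have r7: "?r7 rn = n" "?r7 rT = T" "?r7 rneg = neg" "?r7 rC = C" "?r7 rR = R" "?r7 rn2 = n2" "?r7 rM = M"
      using r5(1-4) r5(5)[of rn] r5(5)[of rT] r5(5)[of rneg] r3
      by (simp_all add: C_def R_def n2_def M_def)
    show "hoare M (r5, A)
      (Assign rn2 (Plus (Plus (Var rn) (Var rn)) (Num 2)) ;; Assign rM (Plus (Var rR) (Var rn2)) ;; pow_table) Q"
    proof (intro hoare_Then hoare_Assign hoare_pow_table)
      show "?r7 rM \<le> M" using r7 by simp
      fix r' A' assume *: "\<And>y. y \<noteq> ri \<Longrightarrow> r' y = ?r7 y" "\<And>c. c \<noteq> aPow \<Longrightarrow> A' c = A c"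
        "\<forall>e\<le>?r7 rM. A' aPow e = 2 ^ e"
      show "Q (r', A')"
      proof (rule Q)
        show "env r' A'"
          unfolding env_def using *(3) r7 assms(1)
          by (simp only: *(1) *(2) r7 rel_simps if_False simp_thms numeral_eq_iff semiring_norm num.distinct)
      qed
    qed simp_all
  qed
qed simp_all

definition reach_table :: "(nat \<Rightarrow> nat \<Rightarrow> nat) \<Rightarrow> bool" where
  "reach_table A \<longleftrightarrow> (\<forall>i<n. \<forall>j<n. A aReach (n * i + j) \<noteq> 0 \<longleftrightarrow> (i, j) \<in> E\<^sup>*)"

lemma env_frame:
  assumes "env r A" "\<And>y. 2 \<le> y \<Longrightarrow> y < rans \<Longrightarrow> r' y = r y" "\<And>c. c \<le> aPow \<Longrightarrow> A' c = A c"
  shows "env r' A'"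
  using assms(1) by (simp add: env_def assms(2,3))

lemma index_eqD: "n * i + j = n * i' + j' \<Longrightarrow> j < n \<Longrightarrow> j' < n \<Longrightarrow> i = i' \<and> j = j'" for i i' j j' :: nat
proof -
  assume *: "n * i + j = n * i' + j'" "j < n" "j' < n"
  have "i = (n * i + j) div n" using *(2) by simp
  also have "\<dots> = i'" using *(3) by (simp add: *(1))
  finally show ?thesis using *(1) by simp
qed

text \<open>A set closed under arcs that misses \<open>t\<close> contains no vertex from which
  \<open>t\<close> can be reached; conversely, the vertices that cannot reach \<open>t\<close> form
  such a set and therefore lie in the greatest one.\<close>

lemma unreachable_gfp:
  assumes "t < n" "X \<subseteq> {..<n}"
    and stable: "\<And>v. v \<in> X \<Longrightarrow> v \<noteq> t \<and> (\<forall>w<n. (v, w) \<in> E \<longrightarrow> w \<in> X)"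
    and greatest: "\<And>S. S \<subseteq> {..<n} \<Longrightarrow> (\<And>X v. S \<subseteq> X \<Longrightarrow> X \<subseteq> {..<n} \<Longrightarrow> v \<in> S \<Longrightarrow>
      v \<noteq> t \<and> (\<forall>w<n. (v, w) \<in> E \<longrightarrow> w \<in> X)) \<Longrightarrow> S \<subseteq> X"
    and "i < n"
  shows "i \<notin> X \<longleftrightarrow> (i, t) \<in> E\<^sup>*"
proof
  assume "(i, t) \<in> E\<^sup>*"
  then show "i \<notin> X"
  proof (induction rule: converse_rtrancl_induct)
    case (step v w)
    with E_subset stable[of v] show ?case by auto
  qed (use stable in auto)
next
  have "{v. v < n \<and> (v, t) \<notin> E\<^sup>*} \<subseteq> X"
  proof (rule greatest, blast)
    fix X' v assume *: "{v. v < n \<and> (v, t) \<notin> E\<^sup>*} \<subseteq> X'" "v \<in> {v. v < n \<and> (v, t) \<notin> E\<^sup>*}"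
    then have "v \<noteq> t" by auto
    moreover have "(w, t) \<notin> E\<^sup>*" if "(v, w) \<in> E" for w
      using * that by (auto intro: converse_rtrancl_into_rtrancl)
    ultimately show "v \<noteq> t \<and> (\<forall>w<n. (v, w) \<in> E \<longrightarrow> w \<in> X')" using *(1) by blast
  qed
  moreover assume "i \<notin> X"
  ultimately show "(i, t) \<in> E\<^sup>*" using \<open>i < n\<close> by blast
qed

lemma hoare_reach:
  assumes env: "env r A" and Q: "\<And>r' A'. env r' A' \<Longrightarrow> reach_table A' \<Longrightarrow> Q (r', A')"
  shows "hoare M (r, A) reach_stmt Q"
  unfolding reach_stmt_def
proof (rule hoare_For[where m = n and I = "\<lambda>t r A. env r A \<and>
    (\<forall>j<t. \<forall>i<n. A aReach (n * i + j) \<noteq> 0 \<longleftrightarrow> (i, j) \<in> E\<^sup>*)"])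
  fix t r1 A1
  assume t: "t < n" and I: "env r1 A1 \<and> (\<forall>j<t. \<forall>i<n. A1 aReach (n * i + j) \<noteq> 0 \<longleftrightarrow> (i, j) \<in> E\<^sup>*)"
  let ?r1 = "r1(rt := t)"
  let ?unr = "Conj (Neg (Equal (Var rx) (Var rt))) (Forall 20 rn (Imp (arc_exp rx 20) (Arr aUnr (Var 20))))"
  let ?Post = "\<lambda>(r, A). env r A \<and> (\<forall>j<Suc t. \<forall>i<n. A aReach (n * i + j) \<noteq> 0 \<longleftrightarrow> (i, j) \<in> E\<^sup>*)"
  show "hoare M (?r1, A1) (gfp_loop aUnr rx rz rn ?unr ;;
     For ri rn (Upd aReach (Plus (times_reg rn (Var ri)) (Var rt)) (Neg (Arr aUnr (Var ri))))) ?Post"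
  proof (rule hoare_Then, rule hoare_gfp_loop[where n = n and
      \<Phi> = "\<lambda>X v. v \<noteq> t \<and> (\<forall>w<n. (v, w) \<in> E \<longrightarrow> w \<in> X)"])
    show "?r1 rn = n" "n \<le> M" using I order by (simp_all add: env_def)
  next
    fix r' A' assume *: "\<And>y. y \<noteq> rx \<Longrightarrow> y \<noteq> rz \<Longrightarrow> r' y = ?r1 y" "\<And>c. c \<noteq> aUnr \<Longrightarrow> A' c = A1 c" "r' rx < n"
    have r': "r' rn = n" "r' rt = t" "A' 0 = inp" using *(1)[of rn] *(1)[of rt] *(2)[of 0] I by (simp_all add: env_def)
    show "ebounded M ?unr (r', A') \<and> (holds ?unr (r', A') \<longleftrightarrow>
        r' rx \<noteq> t \<and> (\<forall>w<n. (r' rx, w) \<in> E \<longrightarrow> w \<in> support n (A' aUnr)))"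
      using r' *(3) order by (auto simp: holds_arc_exp ebounded_arc_demand support_def)
  next
    fix r2 A2
    let ?X = "support n (A2 aUnr)"
    assume *: "\<And>y. y \<noteq> rx \<Longrightarrow> y \<noteq> rz \<Longrightarrow> r2 y = ?r1 y" "\<And>c. c \<noteq> aUnr \<Longrightarrow> A2 c = A1 c"
      "\<And>v. v \<in> ?X \<Longrightarrow> v \<noteq> t \<and> (\<forall>w<n. (v, w) \<in> E \<longrightarrow> w \<in> ?X)"
      "\<And>S. S \<subseteq> {..<n} \<Longrightarrow> (\<And>X v. S \<subseteq> X \<Longrightarrow> X \<subseteq> {..<n} \<Longrightarrow> v \<in> S \<Longrightarrow>
          v \<noteq> t \<and> (\<forall>w<n. (v, w) \<in> E \<longrightarrow> w \<in> X)) \<Longrightarrow> S \<subseteq> ?X"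
    have env2: "env r2 A2" 
    proof (rule env_frame)
      show "env r1 A1" using I by blast
    qed (use *(1,2) in simp_all)
    have unr: "A2 aUnr i = 0 \<longleftrightarrow> (i, t) \<in> E\<^sup>*" if "i < n" for i
    proof -
      have "?X \<subseteq> {..<n}" by (auto simp: support_def)
      then have "i \<notin> ?X \<longleftrightarrow> (i, t) \<in> E\<^sup>*"
        by (rule unreachable_gfp[OF t]) (fact *(3), fact *(4), fact that)
      then show ?thesis using that by (simp add: support_def)
    qed
    have old: "A2 aReach = A1 aReach" "r2 rt = t" "r2 rn = n" using *(1,2) env2 by (simp_all add: env_def)
    show "hoare M (r2, A2)
      (For ri rn (Upd aReach (Plus (times_reg rn (Var ri)) (Var rt)) (Neg (Arr aUnr (Var ri))))) ?Post"
    proof (rule hoare_For[where m = n and I = "\<lambda>i r A. (\<forall>y. y \<noteq> ri \<longrightarrow> r y = r2 y) \<and>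
        (\<forall>c. c \<noteq> aReach \<longrightarrow> A c = A2 c) \<and>
        (\<forall>j<t. \<forall>i<n. A aReach (n * i + j) \<noteq> 0 \<longleftrightarrow> (i, j) \<in> E\<^sup>*) \<and>
        (\<forall>i'<i. A aReach (n * i' + t) \<noteq> 0 \<longleftrightarrow> (i', t) \<in> E\<^sup>*)"])
      fix i r A assume i: "i < n" and J: "(\<forall>y. y \<noteq> ri \<longrightarrow> r y = r2 y) \<and>
        (\<forall>c. c \<noteq> aReach \<longrightarrow> A c = A2 c) \<and>
        (\<forall>j<t. \<forall>i<n. A aReach (n * i + j) \<noteq> 0 \<longleftrightarrow> (i, j) \<in> E\<^sup>*) \<and>
        (\<forall>i'<i. A aReach (n * i' + t) \<noteq> 0 \<longleftrightarrow> (i', t) \<in> E\<^sup>*)"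
      have r: "r rn = n" "r rt = t" "A aUnr = A2 aUnr" using J old by simp_all
      show "hoare M (r(ri := i), A) (Upd aReach (Plus (times_reg rn (Var ri)) (Var rt)) (Neg (Arr aUnr (Var ri))))
         (\<lambda>(r, A). (\<forall>y. y \<noteq> ri \<longrightarrow> r y = r2 y) \<and>
        (\<forall>c. c \<noteq> aReach \<longrightarrow> A c = A2 c) \<and>
        (\<forall>j<t. \<forall>i<n. A aReach (n * i + j) \<noteq> 0 \<longleftrightarrow> (i, j) \<in> E\<^sup>*) \<and>
        (\<forall>i'<Suc i. A aReach (n * i' + t) \<noteq> 0 \<longleftrightarrow> (i', t) \<in> E\<^sup>*))"
      proof (rule hoare_Upd)
        let ?v = "of_bool ((i, t) \<in> E\<^sup>*)"
        let ?A = "A(aReach := (A aReach)(n * i + t := ?v))"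
        have upd: "?A aReach (n * i' + j) = (if i' = i \<and> j = t then ?v else A aReach (n * i' + j))"
          if "j < n" for i' j using index_eqD[of i' j i t] that t by auto
        have "eval (Plus (times_reg rn (Var ri)) (Var rt)) (r(ri := i), A) = n * i + t"
          "eval (Neg (Arr aUnr (Var ri))) (r(ri := i), A) = ?v"
          using r unr[OF i] by (simp_all add: holds_def)
        moreover have "\<forall>j<t. \<forall>i<n. ?A aReach (n * i + j) \<noteq> 0 \<longleftrightarrow> (i, j) \<in> E\<^sup>*"
        proof (intro allI impI)
          fix j i' assume "j < t" "i' < n"
          with J t upd[of j i'] show "?A aReach (n * i' + j) \<noteq> 0 \<longleftrightarrow> (i', j) \<in> E\<^sup>*" by simp
        qed
        moreover have "\<forall>i'<Suc i. ?A aReach (n * i' + t) \<noteq> 0 \<longleftrightarrow> (i', t) \<in> E\<^sup>*"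
        proof (intro allI impI)
          fix i' assume "i' < Suc i"
          then consider "i' = i" | "i' < i" by linarith
          then show "?A aReach (n * i' + t) \<noteq> 0 \<longleftrightarrow> (i', t) \<in> E\<^sup>*"
            by cases (use J upd[OF t, of i'] in simp_all)
        qed
        ultimately show "case (r(ri := i), A(aReach := (A aReach)
            (eval (Plus (times_reg rn (Var ri)) (Var rt)) (r(ri := i), A) :=
             eval (Neg (Arr aUnr (Var ri))) (r(ri := i), A)))) of (r, A) \<Rightarrow>
          (\<forall>y. y \<noteq> ri \<longrightarrow> r y = r2 y) \<and> (\<forall>c. c \<noteq> aReach \<longrightarrow> A c = A2 c) \<and>
          (\<forall>j<t. \<forall>i<n. A aReach (n * i + j) \<noteq> 0 \<longleftrightarrow> (i, j) \<in> E\<^sup>*) \<and>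
          (\<forall>i'<Suc i. A aReach (n * i' + t) \<noteq> 0 \<longleftrightarrow> (i', t) \<in> E\<^sup>*)"
          using J by simp
      qed (use r order in simp_all)
    next
      fix r A assume J: "(\<forall>y. y \<noteq> ri \<longrightarrow> r y = r2 y) \<and>
        (\<forall>c. c \<noteq> aReach \<longrightarrow> A c = A2 c) \<and>
        (\<forall>j<t. \<forall>i<n. A aReach (n * i + j) \<noteq> 0 \<longleftrightarrow> (i, j) \<in> E\<^sup>*) \<and>
        (\<forall>i'<n. A aReach (n * i' + t) \<noteq> 0 \<longleftrightarrow> (i', t) \<in> E\<^sup>*)"
      then have "env r A" by (intro env_frame[OF env2]) auto
      with J show "?Post (r, A)" by (simp add: less_Suc_eq)
    qed (use I old order in simp_all)
  qed simp_all
next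
  show "r rn = n" "n \<le> M" using env order by (simp_all add: env_def)
  fix r' A' assume "env r' A' \<and> (\<forall>j<n. \<forall>i<n. A' aReach (n * i + j) \<noteq> 0 \<longleftrightarrow> (i, j) \<in> E\<^sup>*)"
  then show "Q (r', A')" by (intro Q) (auto simp: reach_table_def)
qed (use env in simp)

section \<open>Search over colourings and digraphs on the colours\<close>

definition Rel :: "(nat \<times> nat) set" where
  "Rel = E\<^sup>* \<inter> {..<n} \<times> {..<n}"

lemma routing_Rel: "routing {..<n} Rel K"
proof
  show "trans Rel" by (rule transI) (auto simp: Rel_def intro: rtrancl_trans)
qed (use K_subset_n in \<open>auto simp: Rel_def\<close>)

interpretation rt: routing "{..<n}" Rel T K
  by (rule routing_Rel)

text \<open>A mask with too many bits can produce colours outside the range. Any default below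
  \<open>C\<close> is harmless, since acceptance is sound for every colouring.\<close>

definition col :: "nat \<Rightarrow> nat \<Rightarrow> nat" where
  "col y x = (if colour M y x < C then colour M y x else 0)"

text \<open>The binary expansion of \<open>N\<close>, read as an adjacency matrix row by
  row.\<close>

definition pat :: "nat \<Rightarrow> (nat \<times> nat) set" where
  "pat N = {(c, c'). c < C \<and> c' < C \<and> bit N (C * c + c')}"

lemma col_less: "col y x < C"
  using order by (simp add: col_def)

lemma pair_index_less: "c < C \<Longrightarrow> c' < C \<Longrightarrow> C * c + c' < C * C"
proof -
  assume "c < C" "c' < C"
  then have "C * c + c' < C * Suc c" "C * Suc c \<le> C * C" by (simp, intro mult_le_mono) auto
  then show ?thesis by linarith
qed

lemma eval_colour_exp:
  assumes "env r A" "r ry < M" "r ri < M"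
  shows "eval colour_exp (r, A) = colour M (r ry) (r ri)"
proof -
  have A: "\<forall>e\<le>M. A aPow e = 2 ^ e" "r rM = M" using assms(1) by (auto simp: env_def)
  have rank: "(\<Sum>i<e. of_bool (bit (r ry) i)) \<le> e" for e :: nat
    using sum_bounded_above[of "{..<e}" "\<lambda>i. of_bool (bit (r ry) i)" "1::nat"] by simp
  show ?thesis
    unfolding colour_exp_def colour_def eval.simps(7)
  proof (intro sum.cong refl)
    show "{..<fst (r, A) rM} = {..<M}" using A by simp
    fix e assume e: "e \<in> {..<M}"
    have "eval (Sum 25 24 (If (bit_exp ry (Var 25)) (Num 1) (Num 0))) (r(24 := e), A) = bit_rank (r ry) e"
      using A assms e by (simp add: eval_If_holds bit_exp_correct[of M] bit_rank_def of_bool_def cong: if_cong del: sum_of_bool_eq eval.simps(6))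
    \<comment> \<open>The rank is used as an index into the table of powers, which ends at
      \<open>M\<close>.\<close>
    moreover have "bit_rank (r ry) e \<le> M" using rank[of e] e by (simp add: bit_rank_def del: sum_of_bool_eq)
    ultimately show "eval (If (Conj (bit_exp ry (Var 24)) (bit_exp ri (Var 24)))
        (Arr aPow (Sum 25 24 (If (bit_exp ry (Var 25)) (Num 1) (Num 0)))) (Num 0)) (set_reg 24 e (r, A)) =
        (if bit (r ry) e \<and> bit (r ri) e then 2 ^ bit_rank (r ry) e else 0)"
      using A assms e by (simp add: eval_If_holds bit_exp_correct[of M] del: eval.simps(6,7))
  qed
qed

lemma ebounded_colour_exp: "env r A \<Longrightarrow> ebounded M colour_exp (r, A)"
  by (auto simp: colour_exp_def env_def ebounded_bit_exp)

definition table :: "nat \<Rightarrow> (nat \<Rightarrow> nat \<Rightarrow> nat) \<Rightarrow> bool" where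
  "table y A \<longleftrightarrow> reach_table A \<and> (\<forall>x<n. A aCol x = col y x)"

lemma bit_exp_pat:
  assumes "env r A" "r rN < R" "eval e (r, A) < C" "r j < C" "26 \<notin> evars e" "30 \<notin> evars e" "31 \<notin> evars e"
    "j \<noteq> 26" "j \<noteq> 30" "j \<noteq> 31"
  shows "holds (bit_exp rN (Plus (times_reg rC e) (Var j))) (r, A) \<longleftrightarrow> (eval e (r, A), r j) \<in> pat (r rN)"
proof -
  have "eval (Plus (times_reg rC e) (Var j)) (r, A) = C * eval e (r, A) + r j"
    using assms by (simp add: env_def eval_upd_fresh)
  moreover have "C * eval e (r, A) + r j < M" using pair_index_less[OF assms(3,4)] order by linarith
  moreover have "r rN < M" using assms(2) order by linarith
  ultimately show ?thesis
    using assms bit_exp_correct[of M A r "Plus (times_reg rC e) (Var j)" rN]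
    by (simp add: env_def pat_def del: eval.simps)
qed

lemma ebounded_bit_exp_pat:
  assumes "env r A" "ebounded M e (r, A)" "26 \<notin> evars e" "30 \<notin> evars e" "31 \<notin> evars e"
    "j \<noteq> 30" "j \<noteq> 31"
  shows "ebounded M (bit_exp rN (Plus (times_reg rC e) (Var j))) (r, A)"
  using assms order by (intro ebounded_bit_exp) (auto simp: env_def eval_upd_fresh)

lemma env_upd: "\<not> (2 \<le> x \<and> x < rans) \<Longrightarrow> env (r(x := i)) A = env r A"
  by (auto simp: env_def)

lemma holds_terminal_exp:
  assumes "env r A" "r w < n" "w \<noteq> 22" "w \<noteq> 26"
  shows "holds (terminal_exp w) (r, A) \<longleftrightarrow> r w \<in> Field K"
proof -
  have "r rn = n" "A 0 = inp" using assms(1) by (auto simp: env_def)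
  then have "holds (terminal_exp w) (r, A) \<longleftrightarrow> (\<exists>i<n. (r w, i) \<in> K \<or> (i, r w) \<in> K)"
    using assms by (simp add: terminal_exp_def holds_demand_exp cong: conj_cong)
  also have "\<dots> \<longleftrightarrow> r w \<in> Field K" using K_subset_n by (auto simp: Field_def)
  finally show ?thesis .
qed

lemma viable_exp_correct:
  assumes env: "env r A" and tab: "table y A" and N: "r rN < R" and x: "r rx < n"
  shows "ebounded M viable_exp (r, A)"
    and "holds viable_exp (r, A) \<longleftrightarrow> rt.viable (col y) (pat (r rN)) (support n (A aX)) (r rx)"
proof -
  have r: "r rn = n" "r rC = C" "r rM = M" using env by (auto simp: env_def)
  show "ebounded M viable_exp (r, A)"
    using env order r
    by (simp add: viable_exp_def terminal_exp_def ebounded_arc_demand env_upd ebounded_bit_exp_pat)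
  let ?v = "r rx"
  have "holds viable_exp (r, A) \<longleftrightarrow>
    (\<forall>w<n. w \<in> Field K \<and> col y w = col y ?v \<longrightarrow> w = ?v) \<and>
    (\<forall>c<C. (col y ?v, c) \<in> pat (r rN) \<longrightarrow>
      (\<exists>w<n. A aX w \<noteq> 0 \<and> col y w = c \<and> (?v, w) \<in> E\<^sup>*))"
    using r x env N tab col_less
    by (simp add: viable_exp_def holds_terminal_exp bit_exp_pat env_upd table_def reach_table_def
        cong: conj_cong)
  also have "\<dots> \<longleftrightarrow> rt.viable (col y) (pat (r rN)) (support n (A aX)) ?v"
  proof -
    let ?c = "col y ?v" and ?P = "pat (r rN)" and ?X = "support n (A aX)"
    have "(\<forall>w<n. w \<in> Field K \<and> col y w = ?c \<longrightarrow> w = ?v) \<longleftrightarrow> (\<forall>w\<in>Field K. col y w = ?c \<longrightarrow> w = ?v)"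
      using K_subset_n by (auto simp: Field_def)
    moreover have "(\<exists>w<n. A aX w \<noteq> 0 \<and> col y w = c \<and> (?v, w) \<in> E\<^sup>*) \<longleftrightarrow>
        (\<exists>w\<in>?X. col y w = c \<and> (?v, w) \<in> Rel)" for c
      using x by (auto simp: support_def Rel_def)
    moreover have "(\<forall>c<C. (?c, c) \<in> ?P \<longrightarrow> H c) \<longleftrightarrow> (\<forall>c. (?c, c) \<in> ?P \<longrightarrow> H c)" for H
      by (auto simp: pat_def)
    ultimately show ?thesis unfolding rt.viable_def by simp
  qed
  finally show "holds viable_exp (r, A) \<longleftrightarrow> rt.viable (col y) (pat (r rN)) (support n (A aX)) (r rx)" .
qed

text \<open>The colours reachable from \<open>c\<close> form the least closed set containing
  \<open>c\<close>, and its mask is among those enumerated because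
  \<open>2 ^ C \<le> R\<close>.\<close>

lemma rtrancl_iff_closed_masks:
  assumes "c < C" "P \<subseteq> {..<C} \<times> {..<C}"
  shows "(c, d) \<in> P\<^sup>* \<longleftrightarrow>
    (\<forall>Z<R. bit Z c \<and> (\<forall>a<C. \<forall>b<C. bit Z a \<and> (a, b) \<in> P \<longrightarrow> bit Z b) \<longrightarrow> bit Z d)"
proof (intro iffI allI impI)
  fix Z assume "(c, d) \<in> P\<^sup>*" "bit Z c \<and> (\<forall>a<C. \<forall>b<C. bit Z a \<and> (a, b) \<in> P \<longrightarrow> bit Z b)"
  then show "bit Z d" by (induction rule: rtrancl_induct) (use assms in blast)+
next
  assume *: "\<forall>Z<R. bit Z c \<and> (\<forall>a<C. \<forall>b<C. bit Z a \<and> (a, b) \<in> P \<longrightarrow> bit Z b) \<longrightarrow> bit Z d"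
  obtain Z :: nat where Z: "Z < 2 ^ C" "\<forall>e. bit Z e \<longleftrightarrow> e < C \<and> (c, e) \<in> P\<^sup>*"
    using ex_number_with_bits[of C "\<lambda>e. (c, e) \<in> P\<^sup>*"] by blast
  have "(2::nat) ^ C \<le> R" unfolding R_def R_of_def C_def by (intro power_increasing) auto
  then have "Z < R" using Z(1) by linarith
  moreover have "bit Z c" using Z(2) assms(1) by simp
  moreover have "\<forall>a<C. \<forall>b<C. bit Z a \<and> (a, b) \<in> P \<longrightarrow> bit Z b"
    using Z(2) by (auto intro: rtrancl_into_rtrancl)
  ultimately have "bit Z d" using * by blast
  then show "(c, d) \<in> P\<^sup>*" using Z(2) by blast
qed

lemma pattern_reach_exp_correct:
  assumes env: "env r A" and tab: "table y A" and N: "r rN < R" and st: "r s < n" "r t < n" "s < 30" "t < 30"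
  shows "ebounded M (pattern_reach_exp s t) (r, A)"
    and "holds (pattern_reach_exp s t) (r, A) \<longleftrightarrow> (col y (r s), col y (r t)) \<in> (pat (r rN))\<^sup>*"
proof -
  have r: "r rR = R" "r rC = C" "r rM = M" "\<forall>e\<le>M. A aPow e = 2 ^ e" using env by (auto simp: env_def)
  show "ebounded M (pattern_reach_exp s t) (r, A)"
    using env order r st
    by (simp add: pattern_reach_exp_def env_upd ebounded_bit_exp_pat ebounded_bit_exp)
  have col: "A aCol (r s) = col y (r s)" "A aCol (r t) = col y (r t)" using tab st by (auto simp: table_def)
  have less: "z < M" if "z < C" for z using that order by linarith
  have less': "z < M" if "z < R" for z using that order by linarith
  have "holds (pattern_reach_exp s t) (r, A) \<longleftrightarrow>
    (\<forall>Z<R. bit Z (col y (r s)) \<and> (\<forall>a<C. \<forall>b<C. bit Z a \<and> (a, b) \<in> pat (r rN) \<longrightarrow> bit Z b) \<longrightarrow> bit Z (col y (r t)))"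
    using r env N st col col_less less less'
    by (simp add: pattern_reach_exp_def bit_exp_correct[of M] bit_exp_pat env_upd)
  also have "\<dots> \<longleftrightarrow> (col y (r s), col y (r t)) \<in> (pat (r rN))\<^sup>*"
    by (rule rtrancl_iff_closed_masks[symmetric]) (auto simp: col_less pat_def)
  finally show "holds (pattern_reach_exp s t) (r, A) \<longleftrightarrow> (col y (r s), col y (r t)) \<in> (pat (r rN))\<^sup>*" .
qed

definition accept :: "nat \<Rightarrow> nat \<Rightarrow> nat set \<Rightarrow> bool" where
  "accept y N X \<longleftrightarrow> (\<forall>c<C. card (pat N `` {c}) \<le> T) \<and>
     (\<forall>(s, t)\<in>K. s \<in> X \<and> t \<in> X \<and> (col y s, col y t) \<in> (pat N)\<^sup>*)"

lemma accept_exp_correct: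
  assumes env: "env r A" and tab: "table y A" and N: "r rN < R"
  shows "ebounded M accept_exp (r, A)"
    and "holds accept_exp (r, A) \<longleftrightarrow> accept y (r rN) (support n (A aX))"
proof -
  have r: "r rn = n" "r rC = C" "r rM = M" "r rT = T" "A 0 = inp" using env by (auto simp: env_def)
  show "ebounded M accept_exp (r, A)"
    using env order r tab N
    by (simp add: accept_exp_def env_upd ebounded_arc_demand pattern_reach_exp_correct(1)[where y = y]
        ebounded_bit_exp_pat)
  have row: "(\<Sum>c'<C. of_bool ((c, c') \<in> pat (r rN))) = card (pat (r rN) `` {c})" for c
  proof -
    have "(\<Sum>c'<C. of_bool ((c, c') \<in> pat (r rN))) = card ({..<C} \<inter> {c'. (c, c') \<in> pat (r rN)})"
      by simp
    also have "{..<C} \<inter> {c'. (c, c') \<in> pat (r rN)} = pat (r rN) `` {c}" by (auto simp: pat_def)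
    finally show ?thesis .
  qed
  have "holds accept_exp (r, A) \<longleftrightarrow>
    (\<forall>c<C. (\<Sum>c'<C. of_bool ((c, c') \<in> pat (r rN))) \<le> T) \<and>
    (\<forall>s<n. \<forall>t<n. (s, t) \<in> K \<longrightarrow> A aX s \<noteq> 0 \<and> A aX t \<noteq> 0 \<and> (col y s, col y t) \<in> (pat (r rN))\<^sup>*)"
    using r env N tab
    by (simp add: accept_exp_def bit_exp_pat env_upd holds_demand_exp pattern_reach_exp_correct(2)[where y = y]
        eval_If_holds of_bool_def cong: if_cong del: sum_of_bool_eq eval.simps(6))
  also have "\<dots> \<longleftrightarrow> accept y (r rN) (support n (A aX))"
  proof -
    have "(\<forall>s<n. \<forall>t<n. (s, t) \<in> K \<longrightarrow> A aX s \<noteq> 0 \<and> A aX t \<noteq> 0 \<and> H s t) \<longleftrightarrow>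
        (\<forall>(s, t)\<in>K. s \<in> support n (A aX) \<and> t \<in> support n (A aX) \<and> H s t)" for H
      using K_subset_n by (auto simp: support_def)
    then show ?thesis unfolding row accept_def by simp
  qed
  finally show "holds accept_exp (r, A) \<longleftrightarrow> accept y (r rN) (support n (A aX))" .
qed


text \<open>What is remembered about the set computed by the fixed point loop: the first part yields
  soundness, the second completeness.\<close>

definition admissible :: "nat \<Rightarrow> nat \<Rightarrow> nat set \<Rightarrow> bool" where
  "admissible y N X \<longleftrightarrow> (\<forall>v\<in>X. rt.viable (col y) (pat N) X v) \<and>
     (\<forall>S\<subseteq>{..<n}. (\<forall>X v. S \<subseteq> X \<longrightarrow> v \<in> S \<longrightarrow> rt.viable (col y) (pat N) X v) \<longrightarrow> S \<subseteq> X)"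

lemma finite_pat: "finite (pat N `` A)"
  by (rule finite_subset[of _ "{..<C}"]) (auto simp: pat_def)

lemma accept_sound:
  assumes "admissible y N X" "accept y N X"
  shows "\<exists>F. rt.solution F"
proof (rule rt.solution_from_pattern)
  show "rt.viable (col y) (pat N) X v" if "v \<in> X" for v using assms(1) that by (auto simp: admissible_def)
  show "Field K \<subseteq> X" using assms(2) by (auto simp: accept_def Field_def)
  show "(col y s, col y t) \<in> (pat N)\<^sup>*" if "(s, t) \<in> K" for s t
    using assms(2) that by (auto simp: accept_def)
  show "finite (pat N `` {col y v}) \<and> card (pat N `` {col y v}) \<le> T" for v
    using assms(2) col_less finite_pat by (auto simp: accept_def)
qed

text \<open>The witnesses come from a small solution: \<open>y\<close> selects bits that separate
  its support, and \<open>N\<close> encodes its coloured image. The support is viable in each of its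
  supersets, so every admissible set contains it, and with it all terminals.\<close>

lemma accept_complete:
  assumes "rt.solution F\<^sub>0"
  shows "\<exists>y<n2. \<exists>N<R. \<forall>X. admissible y N X \<longrightarrow> accept y N X"
proof -
  obtain F where F: "rt.solution F" "card (Field F \<union> Field K) \<le> 2 * card K * (card K + 1)"
    using rt.small_solution[OF assms] by blast
  let ?S = "Field F \<union> Field K"
  have S: "?S \<subseteq> {..<n}"
  proof -
    have "F \<subseteq> Rel" using F(1) unfolding rt.solution_def by simp
    then have "F \<subseteq> {..<n} \<times> {..<n}" using rt.R_subset by (rule subset_trans)
    with K_subset_n show ?thesis by (auto simp: Field_def)
  qed
  obtain y where y: "y < n2" "inj_on (colour M y) ?S" "\<forall>x. colour M y x < C"
  proof -
    have "card ?S \<le> q_of k" "2 * n + 2 \<le> M" using F(2) order by (simp_all add: k_def q_of_def n2_def)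
    from ex_injective_colour[OF S this] that show thesis by (auto simp: n2_def C_def C_of_def)
  qed
  have col: "col y = colour M y" using y(3) by (auto simp: col_def)
  define P where "P = (\<lambda>(u, w). (col y u, col y w)) ` F"
  define H where "H e \<longleftrightarrow> (\<exists>c<C. \<exists>c'<C. e = C * c + c' \<and> (c, c') \<in> P)" for e
  obtain N :: nat where N: "N < 2 ^ (C * C)" "\<forall>e. bit N e \<longleftrightarrow> e < C * C \<and> H e"
    using ex_number_with_bits[of "C * C" H] by blast
  have NR: "N < R" using N(1) by (simp add: R_def R_of_def C_def)
  have "bit N (C * c + c') \<longleftrightarrow> (c, c') \<in> P" if c: "c < C" "c' < C" for c c'
  proof
    assume "bit N (C * c + c')"
    then obtain d d' where d: "d < C" "d' < C" "C * c + c' = C * d + d'" "(d, d') \<in> P"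
      using N(2) unfolding H_def by blast
    have "c = (C * c + c') div C" using c by simp
    also have "\<dots> = d" unfolding d(3) using d(2) by simp
    finally show "(c, c') \<in> P" using d by simp
  next
    assume "(c, c') \<in> P"
    then have "H (C * c + c')" using c unfolding H_def by blast
    with pair_index_less[OF c] N(2) show "bit N (C * c + c')" by simp
  qed
  note bits = this
  have P_less: "c < C \<and> c' < C" if "(c, c') \<in> P" for c c'
    using that col_less by (auto simp: P_def)
  have pat: "pat N = P"
  proof (rule set_eqI, rule prod.induct)
    fix c c'
    show "(c, c') \<in> pat N \<longleftrightarrow> (c, c') \<in> P"
      using bits[of c c'] P_less[of c c'] unfolding pat_def mem_Collect_eq prod.case by blast
  qed
  have inj: "inj_on (col y) ?S" using y(2) by (simp add: col)
  note sol = rt.pattern_from_solution[OF F(1) inj, folded P_def, folded pat]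
  have "accept y N X" if X: "admissible y N X" for X
  proof -
    have SX: "?S \<subseteq> X"
    proof (rule conjunct2[OF X[unfolded admissible_def], rule_format, OF S])
      fix X v assume "?S \<subseteq> X" "v \<in> ?S"
      then show "rt.viable (col y) (pat N) X v" by (rule sol(1))
    qed
    show ?thesis
      unfolding accept_def
    proof (intro conjI allI impI ballI, rule sol(3), clarify)
      fix s t assume st: "(s, t) \<in> K"
      then have "s \<in> ?S" "t \<in> ?S" by (auto simp: Field_def)
      with SX sol(2)[OF st] show "s \<in> X \<and> t \<in> X \<and> (col y s, col y t) \<in> (pat N)\<^sup>*" by blast
    qed
  qed
  then show ?thesis using y(1) NR by blast
qed

lemma hoare_try:
  assumes env: "env r A" and reach: "reach_table A" and y: "r ry = y" "y < n2" and N: "r rN = N" "N < R"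
    and Q: "\<And>r' A' X. env r' A' \<Longrightarrow> reach_table A' \<Longrightarrow> r' ry = y \<Longrightarrow> admissible y N X \<Longrightarrow>
      r' rans = (if accept y N X then 1 else r rans) \<Longrightarrow> Q (r', A')"
  shows "hoare M (r, A) try_stmt Q"
  unfolding try_stmt_def
proof (rule hoare_Then, rule hoare_For[where m = n and I = "\<lambda>i r' A'. (\<forall>y. y \<noteq> ri \<longrightarrow> r' y = r y) \<and>
    (\<forall>c. c \<noteq> aCol \<longrightarrow> A' c = A c) \<and> (\<forall>x<i. A' aCol x = col y x)"])
  show "r rn = n" "n \<le> M" using env order by (simp_all add: env_def)
next
  fix i r' A' assume i: "i < n" and I: "(\<forall>y. y \<noteq> ri \<longrightarrow> r' y = r y) \<and>
    (\<forall>c. c \<noteq> aCol \<longrightarrow> A' c = A c) \<and> (\<forall>x<i. A' aCol x = col y x)"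
  let ?r = "r'(ri := i)"
  have env': "env ?r A'" by (rule env_frame[OF env]) (use I in simp_all)
  moreover have "?r ry < M" "?r ri < M" "?r rC = C" using I y i order env by (simp_all add: env_def)
  ultimately have "eval (If (Less colour_exp (Var rC)) colour_exp (Num 0)) (?r, A') = col y i"
    "ebounded M (If (Less colour_exp (Var rC)) colour_exp (Num 0)) (?r, A')"
    using I y by (simp_all add: eval_If_holds eval_colour_exp ebounded_colour_exp col_def del: eval.simps(6))
  then show "hoare M (?r, A') (Upd aCol (Var ri) (If (Less colour_exp (Var rC)) colour_exp (Num 0)))
    (\<lambda>(r', A'). (\<forall>y. y \<noteq> ri \<longrightarrow> r' y = r y) \<and>
      (\<forall>c. c \<noteq> aCol \<longrightarrow> A' c = A c) \<and> (\<forall>x<Suc i. A' aCol x = col y x))"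
    using I by (intro hoare_Upd) (simp_all add: less_Suc_eq del: eval.simps(6))
next
  fix r1 A1 assume I: "(\<forall>y. y \<noteq> ri \<longrightarrow> r1 y = r y) \<and>
    (\<forall>c. c \<noteq> aCol \<longrightarrow> A1 c = A c) \<and> (\<forall>x<n. A1 aCol x = col y x)"
  have env1: "env r1 A1" by (rule env_frame[OF env]) (use I in simp_all)
  have tab1: "table y A1" using I reach by (simp add: table_def reach_table_def)
  have N1: "r1 rN = N" "r1 ry = y" "r1 rans = r rans" using I y N by simp_all
  show "hoare M (r1, A1) (gfp_loop aX rx rz rn viable_exp ;; Assign rans (If accept_exp (Num 1) (Var rans))) Q"
  proof (rule hoare_Then, rule hoare_gfp_loop[where n = n and \<Phi> = "rt.viable (col y) (pat N)"])
    show "r1 rn = n" "n \<le> M" using env1 order by (simp_all add: env_def)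
  next
    fix r' A' assume *: "\<And>y. y \<noteq> rx \<Longrightarrow> y \<noteq> rz \<Longrightarrow> r' y = r1 y" "\<And>c. c \<noteq> aX \<Longrightarrow> A' c = A1 c" "r' rx < n"
    have "env r' A'" by (rule env_frame[OF env1]) (use *(1,2) in simp_all)
    moreover have "table y A'" using tab1 *(2) by (simp add: table_def reach_table_def)
    moreover have "r' rN = N" using *(1) N1 by simp
    ultimately show "ebounded M viable_exp (r', A') \<and>
        (holds viable_exp (r', A') \<longleftrightarrow> rt.viable (col y) (pat N) (support n (A' aX)) (r' rx))"
      using viable_exp_correct[of r' A' y] N(2) *(3) by simp
  next
    fix r2 A2
    let ?X = "support n (A2 aX)"
    assume *: "\<And>y. y \<noteq> rx \<Longrightarrow> y \<noteq> rz \<Longrightarrow> r2 y = r1 y" "\<And>c. c \<noteq> aX \<Longrightarrow> A2 c = A1 c"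
      "\<And>v. v \<in> ?X \<Longrightarrow> rt.viable (col y) (pat N) ?X v"
      "\<And>S. S \<subseteq> {..<n} \<Longrightarrow> (\<And>X v. S \<subseteq> X \<Longrightarrow> X \<subseteq> {..<n} \<Longrightarrow> v \<in> S \<Longrightarrow>
          rt.viable (col y) (pat N) X v) \<Longrightarrow> S \<subseteq> ?X"
    have env2: "env r2 A2" by (rule env_frame[OF env1]) (use *(1,2) in simp_all)
    have tab2: "table y A2" using tab1 *(2) by (simp add: table_def reach_table_def)
    have N2: "r2 rN = N" "r2 ry = y" "r2 rans = r rans" using *(1) N1 by simp_all
    have adm: "admissible y N ?X"
      unfolding admissible_def using *(3) *(4) by metis
    let ?e = "If accept_exp (Num 1) (Var rans)"
    have acc: "ebounded M accept_exp (r2, A2)" "holds accept_exp (r2, A2) \<longleftrightarrow> accept y N ?X"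
      using accept_exp_correct[OF env2 tab2] N2 N(2) by simp_all
    show "hoare M (r2, A2) (Assign rans ?e) Q"
    proof (rule hoare_Assign)
      show "ebounded M ?e (r2, A2)" using acc(1) by simp
      show "Q (r2(rans := eval ?e (r2, A2)), A2)"
      proof (rule Q[OF _ _ _ adm])
        show "env (r2(rans := eval ?e (r2, A2))) A2" using env2 by (simp add: env_upd)
        show "reach_table A2" using tab2 by (simp add: table_def)
        show "(r2(rans := eval ?e (r2, A2))) ry = y" using N2 by simp
        show "(r2(rans := eval ?e (r2, A2))) rans = (if accept y N ?X then 1 else r rans)"
          using acc(2) N2 by (simp add: eval_If_holds del: eval.simps(6))
      qed
    qed
  qed simp_all
qed simp

lemma hoare_decide:
  assumes "A 0 = inp"
  shows "hoare M (r, A) decide (\<lambda>(r', A'). r' 0 \<noteq> 0 \<longleftrightarrow> neg = 0 \<and> (\<exists>F. rt.solution F))"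
  unfolding decide_def
proof (rule hoare_Then, rule hoare_setup[where A = A], rule assms, rule hoare_Then, rule hoare_reach, assumption,
    rule hoare_Then, rule hoare_Assign)
  let ?Q = "\<lambda>(r', A'). r' 0 \<noteq> 0 \<longleftrightarrow> neg = 0 \<and> (\<exists>F. rt.solution F)"
  let ?sound = "\<lambda>r A. env r A \<and> reach_table A \<and> (r rans \<noteq> 0 \<longrightarrow> (\<exists>F. rt.solution F))"
  \<comment> \<open>The outer loops do not record which set the fixed point loop returned, so
    success is required for every admissible one.\<close>
  let ?found = "\<lambda>y N. \<forall>X. admissible y N X \<longrightarrow> accept y N X"
  fix r1 A1 assume env1: "env r1 A1" and reach1: "reach_table A1"
  show "hoare M (r1(rans := eval (Num 0) (r1, A1)), A1)
    (For ry rn2 (For rN rR try_stmt) ;; Assign 0 (If (Var rneg) (Num 0) (Var rans))) ?Q"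
  proof (rule hoare_Then, rule hoare_For[where m = n2 and
      I = "\<lambda>y r A. ?sound r A \<and> (\<forall>y'<y. \<forall>N<R. ?found y' N \<longrightarrow> r rans \<noteq> 0)"])
    show "(r1(rans := eval (Num 0) (r1, A1))) rn2 = n2" "n2 \<le> M" using env1 order by (simp_all add: env_def)
    show "?sound (r1(rans := eval (Num 0) (r1, A1))) A1 \<and>
      (\<forall>y'<0. \<forall>N<R. ?found y' N \<longrightarrow> (r1(rans := eval (Num 0) (r1, A1))) rans \<noteq> 0)"
      using env1 reach1 by (simp add: env_upd)
  next
    fix y r A assume y: "y < n2" and I: "?sound r A \<and> (\<forall>y'<y. \<forall>N<R. ?found y' N \<longrightarrow> r rans \<noteq> 0)"
    let ?I = "\<lambda>N r A. ?sound r A \<and> r ry = y \<and> (\<forall>y'<y. \<forall>N<R. ?found y' N \<longrightarrow> r rans \<noteq> 0) \<and>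
      (\<forall>N'<N. ?found y N' \<longrightarrow> r rans \<noteq> 0)"
    show "hoare M (r(ry := y), A) (For rN rR try_stmt)
      (\<lambda>(r, A). ?sound r A \<and> (\<forall>y'<Suc y. \<forall>N<R. ?found y' N \<longrightarrow> r rans \<noteq> 0))"
    proof (rule hoare_For[where m = R and I = ?I])
      show "(r(ry := y)) rR = R" "R \<le> M" using I order by (simp_all add: env_def)
      show "?I 0 (r(ry := y)) A" using I by (simp add: env_upd)
    next
      fix N r A assume N: "N < R" and J: "?I N r A"
      show "hoare M (r(rN := N), A) try_stmt (\<lambda>(r, A). ?I (Suc N) r A)"
      proof (rule hoare_try[of _ _ y N])
        show "env (r(rN := N)) A" using J by (simp add: env_upd)
      next
        fix r' A' X assume *: "env r' A'" "reach_table A'" "r' ry = y" "admissible y N X"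
          "r' rans = (if accept y N X then 1 else (r(rN := N)) rans)"
        have "\<exists>F. rt.solution F" if "r' rans \<noteq> 0"
          using that *(5) J accept_sound[OF *(4)] by (auto split: if_splits)
        moreover have "r' rans \<noteq> 0" if "r rans \<noteq> 0" using that *(5) by simp
        moreover have "r' rans \<noteq> 0" if "?found y N" using that *(4,5) by simp
        ultimately show "case (r', A') of (r, A) \<Rightarrow> ?I (Suc N) r A"
          unfolding prod.case using *(1-3) J less_Suc_eq by blast
      qed (use J y N in simp_all)
    next
      fix r A assume J: "?I R r A"
      then show "case (r, A) of (r, A) \<Rightarrow> ?sound r A \<and> (\<forall>y'<Suc y. \<forall>N<R. ?found y' N \<longrightarrow> r rans \<noteq> 0)"
        unfolding prod.case less_Suc_eq by blast
    qed
  next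
    fix r2 A2 assume I: "?sound r2 A2 \<and> (\<forall>y'<n2. \<forall>N<R. ?found y' N \<longrightarrow> r2 rans \<noteq> 0)"
    then have "r2 rans \<noteq> 0 \<longleftrightarrow> (\<exists>F. rt.solution F)" using accept_complete by blast
    then show "hoare M (r2, A2) (Assign 0 (If (Var rneg) (Num 0) (Var rans))) ?Q"
      using I by (intro hoare_Assign) (simp_all add: env_def)
  qed
qed simp

end

section \<open>Running time and the final bound\<close>

lemma runs_program:
  assumes "hoare B (r, A) p Q" "vars p \<subseteq> {..<v}" "0 < v"
  shows "\<exists>t s'. exec (cstmt p v) (r, A) t s' \<and> t \<le> (B + 3) ^ weight (cstmt p v) \<and>
    (\<exists>r' A'. Q (r', A') \<and> result s' = r' 0)"
proof -
  have "bounded B p (r, A)" using assms(1) by (simp add: hoare_def)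
  from runs_cstmt[OF assms(2) order_refl _ this, of r] obtain r' where
    r': "runs B (cstmt p v) (r, A) (r', snd (sem p (r, A)))" "\<forall>x<v. r' x = fst (sem p (r, A)) x" by auto
  then obtain t where "exec (cstmt p v) (r, A) t (r', snd (sem p (r, A)))" "t \<le> wcost B (cstmt p v)"
    by (auto simp: runs_def)
  moreover have "result (r', snd (sem p (r, A))) = fst (sem p (r, A)) 0"
    using r'(2) assms(3) by (simp add: result_def)
  moreover have "Q (fst (sem p (r, A)), snd (sem p (r, A)))" using assms(1) by (simp add: hoare_def)
  ultimately show ?thesis using wcost_le[of B "cstmt p v"] order_trans by blast
qed

lemma vars_decide: "vars decide \<subseteq> {..<40}"
  by (simp add: decide_def setup_def params_def pow_stmt_def pow_table_def reach_stmt_def try_stmt_def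
      gfp_loop_def arc_exp_def demand_exp_def colour_exp_def terminal_exp_def viable_exp_def
      pattern_reach_exp_def accept_exp_def)

lemma computable_power:
  "computable (\<lambda>k. 2 ^ (C_of k * C_of k * d + 3 * d))"
proof -
  define e where "e = Plus (Sum 21 rC2 (Num d)) (Num (3 * d))"
  define p where "p = Assign rk (Arr 0 (Num 0)) ;; params ;; Assign 20 e ;; pow_stmt 0 20"
  have p_vars: "vars p \<subseteq> {..<40}" by (simp add: p_def e_def params_def pow_stmt_def)
  have "\<exists>t s'. exec (cstmt p 40) (init_state [k]) t s' \<and> result s' = 2 ^ (C_of k * C_of k * d + 3 * d)" for k
  proof -
    \<comment> \<open>Computability only asks for halting, so the loop bound may be as large as the
      exponent itself.\<close>
    let ?m = "C_of k * C_of k * d + 3 * d" and ?B = "R_of k + C_of k * C_of k * d + 3 * d"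
    obtain r A where s: "init_state [k] = (r, A)" by (cases "init_state [k]")
    have k: "A 0 0 = k" using s by (auto simp: init_state_def)
    have "hoare ?B (r, A) p (\<lambda>(r', A'). r' 0 = 2 ^ ?m)"
      unfolding p_def
    proof (rule hoare_Then, rule hoare_Assign, simp, rule hoare_Then, rule hoare_params[where k = k])
      show "(r(rk := eval (Arr 0 (Num 0)) (r, A))) rk = k" using k by simp
      show "R_of k \<le> ?B" by simp
      fix r1 assume C2: "r1 rC2 = C_of k * C_of k"
      have e: "eval e (r1, A) = ?m" "ebounded ?B e (r1, A)"
        using C2 params_order(4)[of k] by (simp_all add: e_def)
      show "hoare ?B (r1, A) (Assign 20 e ;; pow_stmt 0 20) (\<lambda>(r', A'). r' 0 = 2 ^ ?m)"
        by (intro hoare_Then hoare_Assign hoare_pow_stmt) (simp_all add: e)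
    qed
    from runs_program[OF this p_vars] s show ?thesis by fastforce
  qed
  then show ?thesis unfolding computable_def by blast
qed

lemma length_le_input_size: "length xs \<le> input_size xs"
  by (induction xs) (auto simp: input_size_def)

lemma nth_adjacency_matrix:
  assumes "i < n" "j < n"
  shows "adjacency_matrix n S ! (n * i + j) = of_bool ((i, j) \<in> S)"
proof -
  have "n * i + j < n * Suc i" using assms by simp
  also have "n * Suc i \<le> n * n" using assms by (intro mult_le_mono) auto
  finally have "n * i + j < n * n" .
  then show ?thesis using assms by (simp add: adjacency_matrix_def product_nth)
qed

theorem theorem11:
  shows "fixed_parameter_tractable MD_RSPP_instances encode num_commodities MD_RSPP"
proof -
  let ?c = "cstmt decide 40"
  define d where "d = weight ?c"
  \<comment> \<open>This is \<open>(8 * R_of k) ^ d\<close>, with the factor 8 contributing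
    \<open>3 * d\<close> to the exponent.\<close>
  define f :: "nat \<Rightarrow> nat" where "f k = 2 ^ (C_of k * C_of k * d + 3 * d)" for k
  have "\<exists>t s'. exec ?c (init_state (encode I)) t s' \<and>
      t \<le> f (num_commodities I) * input_size (encode I) ^ d \<and> (result s' \<noteq> 0 \<longleftrightarrow> MD_RSPP I)"
    if I: "I \<in> MD_RSPP_instances" for I
  proof -
    obtain G T K where I_eq: "I = (G, T, K)" by (cases I)
    obtain n where G: "pair_fin_digraph G" "pverts G = {..<n}" "K \<subseteq> pverts G \<times> pverts G"
      using I by (auto simp: MD_RSPP_instances_def I_eq)
    interpret pair_fin_digraph G by (rule G(1))
    let ?xs = "encode I"
    have xs: "?xs = [n, of_bool (T < 0), nat \<bar>T\<bar>] @ adjacency_matrix n (parcs G) @ adjacency_matrix n K"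
      by (simp add: encode_def I_eq G(2))
    define inp where "inp i = (if i < length ?xs then ?xs ! i else 0)" for i
    have less: "n * i + j < n * n" if "i < n" "j < n" for i j
    proof -
      have "n * i + j < n * Suc i" using that by simp
      also have "n * Suc i \<le> n * n" using that by (intro mult_le_mono) auto
      finally show ?thesis .
    qed
    interpret encoded_instance n "nat \<bar>T\<bar>" "of_bool (T < 0)" "parcs G" K inp
    proof
      show "parcs G \<subseteq> {..<n} \<times> {..<n}" using wellformed' G(2) by auto
      show "K \<subseteq> {..<n} \<times> {..<n}" using G by simp
      show "inp 0 = n" "inp 1 = of_bool (T < 0)" "inp 2 = nat \<bar>T\<bar>"
        by (simp_all add: inp_def xs)
      fix i j assume ij: "i < n" "j < n"
      show "inp (3 + (n * i + j)) = of_bool ((i, j) \<in> parcs G)"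
        using less[OF ij] nth_adjacency_matrix[OF ij]
        by (simp add: inp_def xs length_adjacency_matrix nth_append)
      show "inp (3 + (n * n + (n * i + j))) = of_bool ((i, j) \<in> K)"
        using less[OF ij] nth_adjacency_matrix[OF ij]
        by (simp add: inp_def xs length_adjacency_matrix nth_append)
    qed
    obtain r A where s: "init_state ?xs = (r, A)" by (cases "init_state ?xs")
    have "A 0 = inp" using s by (auto simp: init_state_def inp_def)
    from runs_program[OF hoare_decide[of A r, OF this] vars_decide] obtain t s' where
      t: "exec ?c (init_state ?xs) t s'" "t \<le> (M + 3) ^ d" and
      res: "result s' \<noteq> 0 \<longleftrightarrow> of_bool (T < 0) = (0 :: nat) \<and> (\<exists>F. routing.solution Rel (nat \<bar>T\<bar>) K F)"
      unfolding d_def s by fastforce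
    have "MD_RSPP I \<longleftrightarrow> 0 \<le> T \<and> (\<exists>F. routing.solution Rel (nat T) K F)"
      using MD_RSPP_iff_solution(2)[OF G(1,3), of T] unfolding I_eq Rel_def G(2) .
    with res have "result s' \<noteq> 0 \<longleftrightarrow> MD_RSPP I" by (cases "T < 0") auto
    moreover have "(M + 3) ^ d \<le> f (num_commodities I) * input_size ?xs ^ d"
    proof -
      let ?l = "input_size ?xs"
      \<comment> \<open>Every entry contributes at least its separator to the size. The two matrices
        thus make the size at least linear in \<open>n\<close>, so that \<open>M + 3\<close> is at
        most a multiple of \<open>R\<close> times the size.\<close>
      have "3 + 2 * (n * n) \<le> ?l"
        using length_le_input_size[of ?xs] by (simp add: xs length_adjacency_matrix)
      moreover have "n \<le> n * n" by simp
      ultimately have l: "3 + 2 * n \<le> ?l" by linarith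
      have R: "0 < R" by (simp add: R_def R_of_def)
      have "R \<le> R * ?l" "?l \<le> R * ?l" using R l by simp_all
      then have "M + 3 \<le> 8 * (R * ?l)" using l unfolding M_def n2_def by linarith
      then have "M + 3 \<le> 8 * R * ?l" by (simp only: mult.assoc)
      then have "(M + 3) ^ d \<le> (8 * R * ?l) ^ d" by (rule power_mono) simp
      also have "\<dots> = (8 * R) ^ d * ?l ^ d" by (rule power_mult_distrib)
      also have "8 * R = 2 ^ (C_of k * C_of k + 3)" by (simp add: R_def R_of_def power_add)
      also have "(2 ^ (C_of k * C_of k + 3)) ^ d = f k" unfolding f_def power_mult[symmetric] by (simp add: algebra_simps)
      also have "k = num_commodities I" by (simp add: k_def num_commodities_def I_eq)
      finally show ?thesis .
    qed
    ultimately show ?thesis using t by (meson order_trans)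
  qed
  moreover have "computable f" unfolding f_def by (rule computable_power)
  ultimately show ?thesis unfolding fixed_parameter_tractable_def by blast
qed

end
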